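(* Let $T$ be a tree and let $G \le \mathrm{Aut}(T)$ act geometrically densely on $T$; suppose $G^{++}$ is non-trivial. Then $G$ is almost simple with monolith $\mathrm{D}(G^{++})$, and the action of $\mathrm{D}(G^{++})$ on $T$ is also geometrically dense.
   Context: A group acting by automorphisms on a tree $T$ is geometrically dense if it fixes no end of $T$ and preserves no proper (non-empty) subtree of $T$. A half-tree of $T$ is one of the two connected components obtained by removing an edge from $T$. For a half-tree $Y$, the rigid stabiliser $\mathrm{rist}_G(Y)$ is the subgroup of elements of $G$ that fix pointwise all vertices outside $Y$. $G^{++}$ is the subgroup of $G$ generated by the rigid stabilisers $\mathrm{rist}_G(Y)$ of all half-trees $Y$ of $T$. $\mathrm{D}(\cdot)$ denotes the derived subgroup. The monolith of a group is the intersection of all its non-trivial normal subgroups; a group is almost simple if its monolith is non-abelian and simple. Trees need not be locally finite. *)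

theory Defs
  imports "HOL-Algebra.Bij" "HOL-Algebra.Generated_Groups"
begin

section \<open>Trees\<close>

text \<open>Edges are unordered pairs of distinct vertices. No finiteness is assumed.\<close>

record 'v ugraph =
  verts :: "'v set"
  edges :: "'v set set"

definition simple_graph :: "'v ugraph \<Rightarrow> bool" where
  "simple_graph \<Gamma> \<longleftrightarrow>
     (\<forall>e\<in>edges \<Gamma>. \<exists>x\<in>verts \<Gamma>. \<exists>y\<in>verts \<Gamma>. x \<noteq> y \<and> e = {x, y})"

definition adj :: "'v ugraph \<Rightarrow> 'v \<Rightarrow> 'v \<Rightarrow> bool" where
  "adj \<Gamma> x y \<longleftrightarrow> {x, y} \<in> edges \<Gamma>"

definition connected_graph :: "'v ugraph \<Rightarrow> bool" where
  "connected_graph \<Gamma> \<longleftrightarrow>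
     verts \<Gamma> \<noteq> {} \<and> (\<forall>x\<in>verts \<Gamma>. \<forall>y\<in>verts \<Gamma>. (adj \<Gamma>)\<^sup>*\<^sup>* x y)"

definition graph_cycle :: "'v ugraph \<Rightarrow> 'v list \<Rightarrow> bool" where
  "graph_cycle \<Gamma> xs \<longleftrightarrow>
     3 \<le> length xs \<and> distinct xs \<and> successively (adj \<Gamma>) xs \<and> adj \<Gamma> (last xs) (hd xs)"

definition is_tree :: "'v ugraph \<Rightarrow> bool" where
  "is_tree T \<longleftrightarrow> simple_graph T \<and> connected_graph T \<and> (\<nexists>xs. graph_cycle T xs)"

text \<open>Subtrees are non-empty, because connected graphs are.\<close>

definition subtree :: "'v ugraph \<Rightarrow> 'v ugraph \<Rightarrow> bool" where
  "subtree S T \<longleftrightarrow> is_tree S \<and> verts S \<subseteq> verts T \<and> edges S \<subseteq> edges T"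

text \<open>Components and half-trees are represented by their vertex sets.\<close>

definition components :: "'v ugraph \<Rightarrow> 'v set set" where
  "components \<Gamma> = {{y \<in> verts \<Gamma>. (adj \<Gamma>)\<^sup>*\<^sup>* x y} | x. x \<in> verts \<Gamma>}"

definition remove_edge :: "'v ugraph \<Rightarrow> 'v set \<Rightarrow> 'v ugraph" where
  "remove_edge \<Gamma> e = \<lparr>verts = verts \<Gamma>, edges = edges \<Gamma> - {e}\<rparr>"

definition half_trees :: "'v ugraph \<Rightarrow> 'v set set" where
  "half_trees T = (\<Union>e\<in>edges T. components (remove_edge T e))"

text \<open>An end is a class of rays, two rays being equivalent if they have a common tail.\<close>

definition rays :: "'v ugraph \<Rightarrow> (nat \<Rightarrow> 'v) set" where
  "rays T = {r. inj r \<and> (\<forall>n. adj T (r n) (r (Suc n)))}"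

definition ray_equiv :: "'v ugraph \<Rightarrow> ((nat \<Rightarrow> 'v) \<times> (nat \<Rightarrow> 'v)) set" where
  "ray_equiv T =
     {(r, s). r \<in> rays T \<and> s \<in> rays T \<and> (\<exists>m n. \<forall>k. r (m + k) = s (n + k))}"

definition ends :: "'v ugraph \<Rightarrow> (nat \<Rightarrow> 'v) set set" where
  "ends T = rays T // ray_equiv T"

section \<open>Group actions on trees\<close>

text \<open>As in \<^const>\<open>BijGroup\<close>, automorphisms are extensional, i.e. undefined off the vertex set.
  Inversions of edges are allowed.\<close>

definition automorphisms :: "'v ugraph \<Rightarrow> ('v \<Rightarrow> 'v) set" where
  "automorphisms T =
     {g \<in> Bij (verts T). \<forall>x\<in>verts T. \<forall>y\<in>verts T. adj T (g x) (g y) \<longleftrightarrow> adj T x y}"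

definition Aut :: "'v ugraph \<Rightarrow> ('v \<Rightarrow> 'v) monoid" where
  "Aut T = BijGroup (verts T) \<lparr>carrier := automorphisms T\<rparr>"

lemma group_Aut: "group (Aut T)"
  unfolding Aut_def
proof (rule subgroup.subgroup_is_group[OF _ group_BijGroup], rule group.subgroupI[OF group_BijGroup])
  show "automorphisms T \<subseteq> carrier (BijGroup (verts T))"
    by (auto simp: automorphisms_def BijGroup_def)
  have "(\<lambda>x\<in>verts T. x) \<in> automorphisms T"
    by (simp add: automorphisms_def id_Bij)
  then show "automorphisms T \<noteq> {}" by blast
next
  fix g assume g: "g \<in> automorphisms T"
  then have B: "g \<in> Bij (verts T)" by (simp add: automorphisms_def)
  then have bij: "bij_betw g (verts T) (verts T)" by (simp add: Bij_def)
  have I: "inv_into (verts T) g x \<in> verts T" "g (inv_into (verts T) g x) = x"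
    if "x \<in> verts T" for x
    using that bij by (auto simp: bij_betw_def inv_into_into f_inv_into_f)
  have "adj T (inv_into (verts T) g x) (inv_into (verts T) g y) \<longleftrightarrow> adj T x y"
    if "x \<in> verts T" "y \<in> verts T" for x y
    using g I[OF that(1)] I[OF that(2)] unfolding automorphisms_def by force
  then show "inv\<^bsub>BijGroup (verts T)\<^esub> g \<in> automorphisms T"
    using B by (simp add: inv_BijGroup automorphisms_def restrict_inv_into_Bij)
next
  fix g h assume gh: "g \<in> automorphisms T" "h \<in> automorphisms T"
  then have B: "g \<in> Bij (verts T)" "h \<in> Bij (verts T)" by (simp_all add: automorphisms_def)
  have "h x \<in> verts T" if "x \<in> verts T" for x
    using that B(2) by (auto simp: Bij_def bij_betw_def)
  then show "g \<otimes>\<^bsub>BijGroup (verts T)\<^esub> h \<in> automorphisms T"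
    using gh B by (auto simp: BijGroup_def automorphisms_def compose_Bij compose_eq)
qed

definition graph_image :: "('v \<Rightarrow> 'v) \<Rightarrow> 'v ugraph \<Rightarrow> 'v ugraph" where
  "graph_image g S = \<lparr>verts = g ` verts S, edges = (`) g ` edges S\<rparr>"

definition fixes_end :: "('v \<Rightarrow> 'v) set \<Rightarrow> (nat \<Rightarrow> 'v) set \<Rightarrow> bool" where
  "fixes_end G \<xi> \<longleftrightarrow> (\<forall>g\<in>G. (\<lambda>r. g \<circ> r) ` \<xi> = \<xi>)"

definition geometrically_dense :: "'v ugraph \<Rightarrow> ('v \<Rightarrow> 'v) set \<Rightarrow> bool" where
  "geometrically_dense T G \<longleftrightarrow>
     (\<nexists>\<xi>. \<xi> \<in> ends T \<and> fixes_end G \<xi>) \<and>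
     (\<nexists>S. subtree S T \<and> S \<noteq> T \<and> (\<forall>g\<in>G. graph_image g S = S))"

definition rist :: "'v ugraph \<Rightarrow> ('v \<Rightarrow> 'v) set \<Rightarrow> 'v set \<Rightarrow> ('v \<Rightarrow> 'v) set" where
  "rist T G Y = {g \<in> G. \<forall>x \<in> verts T - Y. g x = x}"

definition plusplus :: "'v ugraph \<Rightarrow> ('v \<Rightarrow> 'v) set \<Rightarrow> ('v \<Rightarrow> 'v) set" where
  "plusplus T G = generate (Aut T) (\<Union>Y\<in>half_trees T. rist T G Y)"

section \<open>Monoliths and almost simple groups\<close>

text \<open>The intersection is taken inside the carrier, which matters only for the trivial group.\<close>

definition monolith :: "('g, 'b) monoid_scheme \<Rightarrow> 'g set" where
  "monolith H = carrier H \<inter> \<Inter>{N. N \<lhd> H \<and> N \<noteq> {\<one>\<^bsub>H\<^esub>}}"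

text \<open>The locale \<open>simple_group\<close> of HOL-Algebra requires \<open>order H > 1\<close>; as \<open>order\<close> is a cardinality
  in \<open>nat\<close>, this excludes all infinite groups. Hence the following version.\<close>

definition is_simple :: "('g, 'b) monoid_scheme \<Rightarrow> bool" where
  "is_simple H \<longleftrightarrow> group H \<and> carrier H \<noteq> {\<one>\<^bsub>H\<^esub>} \<and>
     (\<forall>N. N \<lhd> H \<longrightarrow> N = {\<one>\<^bsub>H\<^esub>} \<or> N = carrier H)"

definition almost_simple :: "('g, 'b) monoid_scheme \<Rightarrow> bool" where
  "almost_simple H \<longleftrightarrow> group H \<and>
     \<not> comm_group (H\<lparr>carrier := monolith H\<rparr>) \<and> is_simple (H\<lparr>carrier := monolith H\<rparr>)"

end

theory Submission
  imports Defs
begin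

text \<open>A group acting on a tree is encoded by what it does to directions: an end \<open>\<xi>\<close> is the function
  sending each vertex to its neighbour in the direction of \<open>\<xi>\<close>, and \<open>\<xi>\<close> is fixed iff this function is
  equivariant. A family of pairwise intersecting subtrees that is invariant under a geometrically
  dense group \<open>H\<close> contains only the whole tree, since otherwise its intersection is a proper
  invariant subtree or, when empty, defines a fixed end. Hence a half-tree can be moved off itself, and into any other half-tree.

  Let \<open>N\<close> be a non-trivial normal subgroup of \<open>H\<close>. Its invariant subtrees pairwise intersect, since
  \<open>N\<close> would otherwise fix the gate between two of them and then, by normality, every vertex. So
  \<open>N\<close> is minimal on \<open>T\<close>; and it cannot fix an end, for it fixes all \<open>H\<close>-translates of that end, and
  two fixed ends would span an invariant line, which is not \<open>T\<close> because \<open>T\<close> branches. Thus \<open>N\<close> is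
  again geometrically dense.

  Now if \<open>a\<close> and \<open>b\<close> are rigid on half-trees \<open>Y\<close> and \<open>Z\<close>, some \<open>n \<in> N\<close> makes \<open>n Y\<close> disjoint from \<open>Z\<close>,
  so that \<open>a\<close>, being congruent to its conjugate by \<open>n\<close> modulo \<open>N\<close>, commutes with \<open>b\<close> modulo \<open>N\<close>.
  Hence \<open>N\<close> contains \<open>D(H\<^sup>+\<^sup>+)\<close>. Applied to \<open>G\<close> this makes \<open>M = D(G\<^sup>+\<^sup>+)\<close> the monolith; applied to
  \<open>M\<close>, for which \<open>D(M\<^sup>+\<^sup>+)\<close> is non-trivial, normal in \<open>G\<close> and therefore equal to \<open>M\<close>, it gives
  simplicity.\<close>

section \<open>Commutators modulo a normal subgroup\<close>

text \<open>Centralizers are subgroups, so commuting passes from a set to the subgroup it generates.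
  This is used twice, in one argument and then, with the roles exchanged, in the other.\<close>

lemma (in group) generate_commute:
  assumes Y: "Y \<subseteq> carrier G" and comm: "\<And>x y. x \<in> Y \<Longrightarrow> y \<in> Y \<Longrightarrow> x \<otimes> y = y \<otimes> x"
    and xy: "x \<in> generate G Y" "y \<in> generate G Y"
  shows "x \<otimes> y = y \<otimes> x"
proof -
  have centralizer: "subgroup {x \<in> carrier G. \<forall>y\<in>Z. x \<otimes> y = y \<otimes> x} G" if Z: "Z \<subseteq> carrier G" for Z
  proof (rule subgroupI)
    show "{x \<in> carrier G. \<forall>y\<in>Z. x \<otimes> y = y \<otimes> x} \<noteq> {}" using Z by force
  next
    fix a assume a: "a \<in> {x \<in> carrier G. \<forall>y\<in>Z. x \<otimes> y = y \<otimes> x}"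
    have "inv a \<otimes> y = y \<otimes> inv a" if y: "y \<in> Z" for y
    proof -
      have yc: "y \<in> carrier G" using Z y by blast
      have "inv a \<otimes> y = inv a \<otimes> (y \<otimes> a) \<otimes> inv a" using a yc by (simp add: m_assoc)
      also have "\<dots> = inv a \<otimes> (a \<otimes> y) \<otimes> inv a" using a y by simp
      also have "\<dots> = y \<otimes> inv a" using a yc by (simp add: m_assoc[symmetric])
      finally show ?thesis .
    qed
    then show "inv a \<in> {x \<in> carrier G. \<forall>y\<in>Z. x \<otimes> y = y \<otimes> x}" using a by simp
  next
    fix a b assume a: "a \<in> {x \<in> carrier G. \<forall>y\<in>Z. x \<otimes> y = y \<otimes> x}"
      and b: "b \<in> {x \<in> carrier G. \<forall>y\<in>Z. x \<otimes> y = y \<otimes> x}"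
    have "a \<otimes> b \<otimes> y = y \<otimes> (a \<otimes> b)" if y: "y \<in> Z" for y
    proof -
      have yc: "y \<in> carrier G" using Z y by blast
      have "a \<otimes> b \<otimes> y = a \<otimes> (y \<otimes> b)" using a b y yc by (simp add: m_assoc)
      also have "\<dots> = y \<otimes> a \<otimes> b" using a b y yc by (simp add: m_assoc[symmetric])
      finally show ?thesis using a b yc by (simp add: m_assoc)
    qed
    then show "a \<otimes> b \<in> {x \<in> carrier G. \<forall>y\<in>Z. x \<otimes> y = y \<otimes> x}" using a b by simp
  qed auto
  have "generate G Y \<subseteq> {x \<in> carrier G. \<forall>y\<in>Y. x \<otimes> y = y \<otimes> x}"
    by (rule generate_subgroup_incl[OF _ centralizer[OF Y]]) (use Y comm in blast)
  then have "Y \<subseteq> {x \<in> carrier G. \<forall>y\<in>generate G Y. x \<otimes> y = y \<otimes> x}" using Y by auto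
  then have "generate G Y \<subseteq> {x \<in> carrier G. \<forall>y\<in>generate G Y. x \<otimes> y = y \<otimes> x}"
    using generate_subgroup_incl[OF _ centralizer] generate_incl[OF Y] by blast
  then show ?thesis using xy by blast
qed

text \<open>In the quotient by \<open>N\<close> the conjugate of \<open>a\<close> by
  \<open>n\<close> has the same image as \<open>a\<close>, so the images of elements of
  \<open>X\<close> commute and generate an abelian subgroup. Commutators from
  \<open>generate G X\<close> then have trivial image.\<close>

lemma (in group) derived_generate_le_normal:
  assumes N: "N \<lhd> G" and X: "X \<subseteq> carrier G"
    and comm: "\<And>a b. a \<in> X \<Longrightarrow> b \<in> X \<Longrightarrow> \<exists>n\<in>N. (n \<otimes> a \<otimes> inv n) \<otimes> b = b \<otimes> (n \<otimes> a \<otimes> inv n)"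
  shows "derived G (generate G X) \<subseteq> N"
proof -
  interpret N: normal N G by (rule N)
  let ?Q = "G Mod N" and ?h = "(#>) N"
  interpret Q: group ?Q by (rule N.factorgroup_is_group)
  interpret h: group_hom G ?Q ?h
    by (rule group_hom.intro[OF group_axioms Q.group_axioms])
      (simp add: group_hom_axioms_def N.r_coset_hom_Mod)
  have hN: "?h n = \<one>\<^bsub>?Q\<^esub>" if "n \<in> N" for n
    using that N.rcos_const by simp
  have hX: "?h a \<otimes>\<^bsub>?Q\<^esub> ?h b = ?h b \<otimes>\<^bsub>?Q\<^esub> ?h a" if ab: "a \<in> X" "b \<in> X" for a b
  proof -
    obtain n where n: "n \<in> N" "(n \<otimes> a \<otimes> inv n) \<otimes> b = b \<otimes> (n \<otimes> a \<otimes> inv n)" using comm ab by blast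
    have c: "n \<in> carrier G" "a \<in> carrier G" "b \<in> carrier G" using n ab X N.subset by auto
    have "?h (n \<otimes> a \<otimes> inv n) = \<one>\<^bsub>?Q\<^esub> \<otimes>\<^bsub>?Q\<^esub> ?h a \<otimes>\<^bsub>?Q\<^esub> inv\<^bsub>?Q\<^esub> \<one>\<^bsub>?Q\<^esub>"
      using c by (simp only: h.hom_mult h.hom_inv m_closed inv_closed hN[OF n(1)])
    also have "\<dots> = ?h a"
      using h.hom_closed[OF c(2)] by (simp only: Q.inv_one Q.r_one Q.l_one)
    finally have conj: "?h (n \<otimes> a \<otimes> inv n) = ?h a" .
    have "?h (n \<otimes> a \<otimes> inv n) \<otimes>\<^bsub>?Q\<^esub> ?h b = ?h b \<otimes>\<^bsub>?Q\<^esub> ?h (n \<otimes> a \<otimes> inv n)"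
      using arg_cong[OF n(2), of ?h] c by (simp only: h.hom_mult m_closed inv_closed)
    then show ?thesis by (simp only: conj)
  qed
  have "derived_set G (generate G X) \<subseteq> N"
  proof
    fix c assume "c \<in> derived_set G (generate G X)"
    then obtain a b where ab: "a \<in> generate G X" "b \<in> generate G X" "c = a \<otimes> b \<otimes> inv a \<otimes> inv b"
      by blast
    have cc: "a \<in> carrier G" "b \<in> carrier G" using ab generate_in_carrier[OF X] by auto
    have img: "?h a \<in> generate ?Q (?h ` X)" "?h b \<in> generate ?Q (?h ` X)"
      using ab h.generate_img[OF X] by auto
    have "?h a \<otimes>\<^bsub>?Q\<^esub> ?h b = ?h b \<otimes>\<^bsub>?Q\<^esub> ?h a"
    proof (rule Q.generate_commute[OF _ _ img])
      show "?h ` X \<subseteq> carrier ?Q" using X h.hom_closed by blast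
    qed (use hX in blast)
    then have "?h (a \<otimes> b) = ?h (b \<otimes> a)" using cc by (simp only: h.hom_mult)
    then have "?h (a \<otimes> b \<otimes> inv (b \<otimes> a)) = \<one>\<^bsub>?Q\<^esub>"
      using cc h.hom_closed[of "b \<otimes> a"] Q.r_inv
      by (simp only: h.hom_mult h.hom_inv m_closed inv_closed)
    then have "N #> c = N" using cc ab(3) by (simp add: inv_mult_group m_assoc)
    then show "c \<in> N" using coset_join1 N.subgroup_axioms cc ab(3) by blast
  qed
  then show ?thesis unfolding derived_def by (rule generate_subgroup_incl[OF _ N.subgroup_axioms])
qed

section \<open>Half-trees and directions\<close>

text \<open>Whenever the next vertex was visited before, the path is cut back to that visit.
  Distinctness is needed to obtain a \<open>graph_cycle\<close>.\<close>

lemma rtranclp_distinct_path: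
  assumes "r\<^sup>*\<^sup>* x y"
  shows "\<exists>xs. xs \<noteq> [] \<and> hd xs = x \<and> last xs = y \<and> distinct xs \<and> successively r xs"
  using assms
proof (induction rule: rtranclp_induct)
  case base
  show ?case by (rule exI[of _ "[x]"]) simp
next
  case (step y z)
  then obtain xs where xs: "xs \<noteq> []" "hd xs = x" "last xs = y" "distinct xs" "successively r xs"
    by blast
  show ?case
  proof (cases "z \<in> set xs")
    case True
    then obtain as bs where ab: "xs = as @ z # bs" by (auto simp: in_set_conv_decomp)
    have "hd (as @ [z]) = x" using xs ab by (cases as) auto
    moreover have "distinct (as @ [z])" "successively r (as @ [z])"
      using xs ab by (auto simp: successively_append_iff)
    ultimately show ?thesis by (intro exI[of _ "as @ [z]"]) simp
  next
    case False
    then show ?thesis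
      using xs step.hyps by (intro exI[of _ "xs @ [z]"]) (auto simp: successively_append_iff)
  qed
qed

locale tree =
  fixes T :: "'v ugraph"
  assumes tree: "is_tree T"
begin

lemma adj_sym: "adj T x y \<Longrightarrow> adj T y x"
  by (simp add: adj_def insert_commute)

lemma adj_verts: "adj T x y \<Longrightarrow> x \<in> verts T \<and> y \<in> verts T \<and> x \<noteq> y"
  using tree unfolding is_tree_def simple_graph_def adj_def by (fastforce simp: doubleton_eq_iff)

lemma edgeE:
  assumes "e \<in> edges T" obtains x y where "adj T x y" "e = {x, y}"
  using assms tree unfolding is_tree_def simple_graph_def adj_def by metis

lemma reach: "x \<in> verts T \<Longrightarrow> y \<in> verts T \<Longrightarrow> (adj T)\<^sup>*\<^sup>* x y"
  using tree unfolding is_tree_def connected_graph_def by blast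

lemma verts_nonempty: "verts T \<noteq> {}"
  using tree unfolding is_tree_def connected_graph_def by blast

lemma adj_remove_edge: "adj (remove_edge T e) x y \<longleftrightarrow> adj T x y \<and> {x, y} \<noteq> e"
  by (auto simp: adj_def remove_edge_def)

lemma reach_remove_edge_sym:
  "(adj (remove_edge T e))\<^sup>*\<^sup>* x y \<Longrightarrow> (adj (remove_edge T e))\<^sup>*\<^sup>* y x"
  by (rule sympD[OF symp_rtranclp]) (auto intro!: sympI simp: adj_remove_edge adj_sym insert_commute)

text \<open>A path from \<open>w\<close> to \<open>v\<close> that avoids the edge would be closed up
  by it to a cycle.\<close>

lemma bridge:
  assumes "adj T v w"
  shows "\<not> (adj (remove_edge T {v, w}))\<^sup>*\<^sup>* w v"
proof
  assume "(adj (remove_edge T {v, w}))\<^sup>*\<^sup>* w v"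
  then obtain xs where xs: "xs \<noteq> []" "hd xs = w" "last xs = v" "distinct xs"
      "successively (adj (remove_edge T {v, w})) xs"
    using rtranclp_distinct_path by metis
  have ne: "v \<noteq> w" using adj_verts[OF assms] by simp
  \<comment> \<open>A single vertex would force \<open>v = w\<close>, and two vertices would use the
    removed edge.\<close>
  obtain x1 x2 x3 ys where "xs = x1 # x2 # x3 # ys"
  proof (cases xs rule: remdups_adj.cases)
    case (3 a b zs)
    then show ?thesis
      using xs that by (cases zs) (auto simp: adj_remove_edge insert_commute)
  qed (use xs ne in auto)
  then have "3 \<le> length xs" by simp
  moreover have "successively (adj T) xs"
    using xs(5) by (rule successively_mono) (auto simp: adj_remove_edge)
  ultimately have "graph_cycle T xs" using xs assms by (simp add: graph_cycle_def)
  then show False using tree unfolding is_tree_def by blast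
qed

text \<open>\<open>side v w\<close> is the half-tree at \<open>w\<close> after removing the edge \<open>{v, w}\<close>, and \<open>dir v u\<close> is the
  neighbour of \<open>v\<close> towards \<open>u\<close> (unspecified if \<open>u = v\<close>).\<close>

definition side :: "'v \<Rightarrow> 'v \<Rightarrow> 'v set" where
  "side v w = {u \<in> verts T. (adj (remove_edge T {v, w}))\<^sup>*\<^sup>* w u}"

definition dir :: "'v \<Rightarrow> 'v \<Rightarrow> 'v" where
  "dir v u = (THE w. adj T v w \<and> u \<in> side v w)"

lemma side_verts: "side v w \<subseteq> verts T"
  by (auto simp: side_def)

lemma side_vertsD: "u \<in> side v w \<Longrightarrow> u \<in> verts T"
  by (simp add: side_def)

lemma side_self: "adj T v w \<Longrightarrow> w \<in> side v w"
  using adj_verts by (auto simp: side_def)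

lemma side_not: "adj T v w \<Longrightarrow> v \<notin> side v w"
  using bridge by (auto simp: side_def)

text \<open>The removed edge is the only way out of a half-tree, and it leads from \<open>w\<close>
  to \<open>v\<close>.\<close>

lemma side_step:
  assumes "adj T v w" "a \<in> side v w" "adj T a b" "\<not> (a = w \<and> b = v)"
  shows "b \<in> side v w"
proof (cases "{a, b} = {v, w}")
  case True
  then show ?thesis using assms side_not by (auto simp: doubleton_eq_iff)
next
  case False
  then have "adj (remove_edge T {v, w}) a b" using assms by (simp add: adj_remove_edge)
  then show ?thesis using assms(2) adj_verts[OF assms(3)]
    by (auto simp: side_def intro: rtranclp.rtrancl_into_rtrancl)
qed

lemma side_compl:
  assumes vw: "adj T v w" and u: "u \<in> verts T"
  shows "u \<in> side w v \<longleftrightarrow> u \<notin> side v w"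
proof
  assume "u \<in> side w v"
  then have "(adj (remove_edge T {v, w}))\<^sup>*\<^sup>* v u"
    by (simp add: side_def insert_commute)
  then show "u \<notin> side v w"
    using bridge[OF vw] reach_remove_edge_sym by (auto simp: side_def dest: rtranclp_trans)
next
  have "(adj T)\<^sup>*\<^sup>* v u" using reach adj_verts[OF vw] u by blast
  then have "u \<in> side v w \<or> u \<in> side w v"
  proof (induction rule: rtranclp_induct)
    case base
    then show ?case using side_self adj_sym vw by blast
  next
    case (step y z)
    then show ?case using side_step side_self adj_sym vw by metis
  qed
  then show "u \<notin> side v w \<Longrightarrow> u \<in> side w v" by blast
qed

lemma side_disjoint: "adj T v w \<Longrightarrow> side v w \<inter> side w v = {}"
  using side_compl side_verts by blast

text \<open>A path starting at \<open>w'\<close> without the edge \<open>{v, w'}\<close> never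
  reaches \<open>v\<close>, so it cannot cross \<open>{v, w}\<close> either. The induction carries
  membership in both half-trees, the first one in order to exclude \<open>v\<close>.\<close>

lemma side_subset_opposite:
  assumes "adj T v w" "adj T v w'" "w \<noteq> w'"
  shows "side v w' \<subseteq> side w v"
proof
  fix u assume "u \<in> side v w'"
  then have "(adj (remove_edge T {v, w'}))\<^sup>*\<^sup>* w' u" by (simp add: side_def)
  then have "u \<in> side v w' \<and> u \<in> side w v"
  proof (induction rule: rtranclp_induct)
    case base
    show ?case using assms adj_sym side_self[OF assms(2)] side_self[of w v] side_step[of w v v w']
      by blast
  next
    case (step a b)
    have ab: "adj T a b" using step by (simp add: adj_remove_edge)
    have nv: "a \<noteq> v" using step assms side_not by blast
    have "b \<in> side v w'" using step ab assms side_step[of v w' a b]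
      by (auto simp: adj_remove_edge insert_commute)
    moreover have "b \<in> side w v" using step ab nv assms side_step[of w v a b] adj_sym by blast
    ultimately show ?case by blast
  qed
  then show "u \<in> side w v" by blast
qed

lemma side_inter_eq:
  assumes "adj T v w" "adj T v w'" "u \<in> side v w" "u \<in> side v w'"
  shows "w = w'"
  using assms side_subset_opposite side_disjoint by blast

lemma dir_exists:
  assumes "v \<in> verts T" "u \<in> verts T" "u \<noteq> v"
  shows "\<exists>w. adj T v w \<and> u \<in> side v w"
proof -
  have "(adj T)\<^sup>*\<^sup>* v u" using reach assms by blast
  then have "u = v \<or> (\<exists>w. adj T v w \<and> u \<in> side v w)"
  proof (induction rule: rtranclp_induct)
    case (step y z)
    then show ?case using side_step side_self by metis
  qed simp
  then show ?thesis using assms by blast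
qed

lemma dir_eqI: "adj T v w \<Longrightarrow> u \<in> side v w \<Longrightarrow> dir v u = w"
  unfolding dir_def using side_inter_eq by blast

lemma dir_adj: "v \<in> verts T \<Longrightarrow> u \<in> verts T \<Longrightarrow> u \<noteq> v \<Longrightarrow> adj T v (dir v u)"
  and dir_side: "v \<in> verts T \<Longrightarrow> u \<in> verts T \<Longrightarrow> u \<noteq> v \<Longrightarrow> u \<in> side v (dir v u)"
proof -
  assume *: "v \<in> verts T" "u \<in> verts T" "u \<noteq> v"
  then obtain w where "adj T v w" "u \<in> side v w" using dir_exists by blast
  moreover from this have "dir v u = w" by (rule dir_eqI)
  ultimately show "adj T v (dir v u)" "u \<in> side v (dir v u)" by simp_all
qed

lemma side_iff_dir:
  assumes "adj T v w"
  shows "u \<in> side v w \<longleftrightarrow> u \<in> verts T \<and> u \<noteq> v \<and> dir v u = w"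
proof
  assume "u \<in> side v w"
  then show "u \<in> verts T \<and> u \<noteq> v \<and> dir v u = w"
    using dir_eqI[OF assms] side_not[OF assms] side_verts[of v w] by auto
next
  assume "u \<in> verts T \<and> u \<noteq> v \<and> dir v u = w"
  then show "u \<in> side v w" using dir_side adj_verts[OF assms] by auto
qed

lemma dir_of_adj: "adj T v w \<Longrightarrow> dir v w = w"
  by (simp add: dir_eqI side_self)

lemma dir_step:
  assumes "adj T a b" "a \<noteq> v" "b \<noteq> v" "v \<in> verts T"
  shows "dir v b = dir v a"
proof -
  have "a \<in> verts T" using adj_verts assms by blast
  then have "adj T v (dir v a)" "a \<in> side v (dir v a)" using dir_adj dir_side assms by auto
  then show ?thesis using side_step[OF _ _ assms(1)] assms(3) dir_eqI by blast
qed

text \<open>The walk need not be shortest. If its last step starts at \<open>x\<close>, then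
  \<open>y\<close> is a neighbour of \<open>x\<close> and \<open>m = 0\<close> will do; otherwise
  the last step does not change the direction seen from \<open>x\<close>.\<close>

lemma dir_walk:
  assumes "(adj T ^^ n) x y" "x \<in> verts T" "x \<noteq> y"
  shows "\<exists>m<n. (adj T ^^ m) (dir x y) y"
  using assms(1,3)
proof (induction n arbitrary: y)
  case (Suc n)
  then obtain z where z: "(adj T ^^ n) x z" "adj T z y" by auto
  show ?case
  proof (cases "x = z")
    case True
    then show ?thesis using z dir_of_adj by (intro exI[of _ 0]) auto
  next
    case False
    then obtain m where m: "m < n" "(adj T ^^ m) (dir x z) z" using Suc.IH z by blast
    have "dir x y = dir x z" using dir_step z(2) False Suc.prems assms(2) by metis
    then have "(adj T ^^ Suc m) (dir x y) y" using m z by auto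
    then show ?thesis using m by (intro exI[of _ "Suc m"]) auto
  qed
qed auto

text \<open>Replaces induction on the distance to \<open>y\<close>: by \<open>dir_walk\<close>, a
  move towards \<open>y\<close> leaves a shorter walk to it.\<close>

lemma dir_induct [consumes 2, case_names target step]:
  assumes "x \<in> verts T" "y \<in> verts T" "P y"
    and step: "\<And>x. x \<in> verts T \<Longrightarrow> x \<noteq> y \<Longrightarrow> P (dir x y) \<Longrightarrow> P x"
  shows "P x"
proof -
  obtain n where "(adj T ^^ n) x y" using reach assms rtranclp_imp_relpowp by metis
  then show ?thesis using assms(1)
  proof (induction n arbitrary: x rule: less_induct)
    case (less n)
    show ?case
    proof (cases "x = y")
      case False
      then obtain m where "m < n" "(adj T ^^ m) (dir x y) y"
        using dir_walk less.prems by blast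
      moreover have "dir x y \<in> verts T"
        using dir_adj[of x y] adj_verts less.prems assms(2) False by blast
      ultimately show ?thesis using less.IH step less.prems False by blast
    qed (use assms(3) in simp)
  qed
qed

section \<open>Convex sets\<close>

text \<open>These are the vertex sets of subtrees together with the empty set, described so that
  intersections and images under automorphisms are easy.\<close>

definition convex :: "'v set \<Rightarrow> bool" where
  "convex S \<longleftrightarrow> S \<subseteq> verts T \<and> (\<forall>x\<in>S. \<forall>y\<in>S. x \<noteq> y \<longrightarrow> dir x y \<in> S)"

lemma convexD: "convex S \<Longrightarrow> x \<in> S \<Longrightarrow> y \<in> S \<Longrightarrow> x \<noteq> y \<Longrightarrow> dir x y \<in> S"
  and convex_verts: "convex S \<Longrightarrow> S \<subseteq> verts T"
  by (auto simp: convex_def)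

lemma convex_Inter: "F \<noteq> {} \<Longrightarrow> (\<And>S. S \<in> F \<Longrightarrow> convex S) \<Longrightarrow> convex (\<Inter>F)"
  unfolding convex_def by blast

lemma convex_connected:
  assumes S: "convex S" and xy: "x \<in> S" "y \<in> S"
  shows "(\<lambda>a b. a \<in> S \<and> b \<in> S \<and> adj T a b)\<^sup>*\<^sup>* x y"
proof -
  have "x \<in> verts T" "y \<in> verts T" using assms convex_verts by auto
  then have "x \<in> S \<longrightarrow> ?thesis"
  proof (induction rule: dir_induct)
    case (step x)
    show ?case
    proof
      assume x: "x \<in> S"
      have "dir x y \<in> S" using convexD[OF S x xy(2)] step by blast
      moreover have "adj T x (dir x y)" using dir_adj step \<open>y \<in> verts T\<close> by blast
      ultimately show "(\<lambda>a b. a \<in> S \<and> b \<in> S \<and> adj T a b)\<^sup>*\<^sup>* x y"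
        using step x by (intro converse_rtranclp_into_rtranclp[of _ x]) auto
    qed
  qed simp
  then show ?thesis using xy by blast
qed

text \<open>Along a path inside \<open>S\<close> the direction from \<open>x\<close> changes only
  when the path leaves \<open>x\<close>, and then it is the next vertex of the path.\<close>

lemma connected_convex:
  assumes S: "S \<subseteq> verts T"
    and conn: "\<And>x y. x \<in> S \<Longrightarrow> y \<in> S \<Longrightarrow> (\<lambda>a b. a \<in> S \<and> b \<in> S \<and> adj T a b)\<^sup>*\<^sup>* x y"
  shows "convex S"
  unfolding convex_def
proof (intro conjI ballI impI S)
  fix x y assume xy: "x \<in> S" "y \<in> S" "x \<noteq> y"
  have "x = y \<or> dir x y \<in> S" using conn[OF xy(1,2)]
  proof (induction rule: rtranclp_induct)
    case (step y z)
    then show ?case using dir_of_adj dir_step xy(1) S by (metis subsetD)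
  qed simp
  then show "dir x y \<in> S" using xy by blast
qed

lemma convex_dir_const:
  assumes "convex S" "v \<in> verts T" "v \<notin> S" "a \<in> S" "b \<in> S"
  shows "dir v a = dir v b"
  using convex_connected[OF assms(1,4,5)]
proof (induction rule: rtranclp_induct)
  case (step y z)
  then show ?case using dir_step assms by metis
qed simp

lemma convex_subset_side:
  assumes "convex S" "v \<in> verts T" "v \<notin> S" "a \<in> S"
  shows "S \<subseteq> side v (dir v a)"
proof
  fix b assume b: "b \<in> S"
  have "b \<in> side v (dir v b)" using b assms convex_verts by (intro dir_side) auto
  then show "b \<in> side v (dir v a)" using convex_dir_const[OF assms b] by simp
qed

text \<open>Leaving the half-tree towards \<open>y\<close> would mean crossing from \<open>w\<close>
  to \<open>v\<close>, which puts \<open>y\<close> on the other side.\<close>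

lemma convex_side:
  assumes "adj T v w" shows "convex (side v w)"
  unfolding convex_def
proof (intro conjI ballI impI side_verts)
  fix x y assume xy: "x \<in> side v w" "y \<in> side v w" "x \<noteq> y"
  then have a: "adj T x (dir x y)" "y \<in> side x (dir x y)"
    using dir_adj dir_side side_verts by blast+
  show "dir x y \<in> side v w"
  proof (rule ccontr)
    assume "dir x y \<notin> side v w"
    then have "x = w" "dir x y = v" using side_step[OF assms xy(1) a(1)] by auto
    then show False using a side_disjoint[OF assms] xy by auto
  qed
qed

section \<open>Automorphisms\<close>

lemma
  assumes "g \<in> automorphisms T"
  shows aut_verts: "x \<in> verts T \<Longrightarrow> g x \<in> verts T"
    and aut_adj: "x \<in> verts T \<Longrightarrow> y \<in> verts T \<Longrightarrow> adj T (g x) (g y) \<longleftrightarrow> adj T x y"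
    and aut_inj: "x \<in> verts T \<Longrightarrow> y \<in> verts T \<Longrightarrow> g x = g y \<longleftrightarrow> x = y"
    and aut_image: "g ` verts T = verts T"
  using assms by (auto simp: automorphisms_def Bij_def bij_betw_def dest: inj_onD)

lemma aut_eqI:
  assumes "g \<in> automorphisms T" "h \<in> automorphisms T" "\<And>x. x \<in> verts T \<Longrightarrow> g x = h x"
  shows "g = h"
  using assms by (intro extensionalityI[of _ "verts T"]) (auto simp: automorphisms_def Bij_def)

lemma aut_side_mem:
  assumes g: "g \<in> automorphisms T" and vw: "adj T v w" and u: "u \<in> side v w"
  shows "g u \<in> side (g v) (g w)"
proof -
  have vwT: "v \<in> verts T" "w \<in> verts T" using adj_verts vw by auto
  have gvw: "adj T (g v) (g w)" using vw vwT by (simp add: aut_adj[OF g])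
  have "(adj (remove_edge T {v, w}))\<^sup>*\<^sup>* w u" using u by (simp add: side_def)
  then show ?thesis
  proof (induction rule: rtranclp_induct)
    case base
    show ?case using gvw side_self by blast
  next
    case (step a b)
    then have ab: "adj T a b" "{a, b} \<noteq> {v, w}" by (simp_all add: adj_remove_edge)
    then have abT: "a \<in> verts T" "b \<in> verts T" using adj_verts by auto
    show ?case
      by (rule side_step[OF gvw step.IH]) (use ab abT vwT in \<open>auto simp: aut_adj[OF g] aut_inj[OF g]\<close>)
  qed
qed

lemma aut_dir:
  assumes g: "g \<in> automorphisms T" and "v \<in> verts T" "u \<in> verts T" "u \<noteq> v"
  shows "dir (g v) (g u) = g (dir v u)"
proof (rule dir_eqI)
  have a: "adj T v (dir v u)" using assms dir_adj by auto
  then show "adj T (g v) (g (dir v u))" using adj_verts by (auto simp: aut_adj[OF g])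
  show "g u \<in> side (g v) (g (dir v u))" using aut_side_mem[OF g a] assms dir_side by auto
qed

lemma aut_side_image:
  assumes g: "g \<in> automorphisms T" and vw: "adj T v w"
  shows "g ` side v w = side (g v) (g w)"
proof
  show "g ` side v w \<subseteq> side (g v) (g w)" using aut_side_mem[OF assms] by auto
  show "side (g v) (g w) \<subseteq> g ` side v w"
  proof
    fix u assume u: "u \<in> side (g v) (g w)"
    then obtain u' where u': "u' \<in> verts T" "u = g u'"
      using side_verts aut_image[OF g] by blast
    have "adj T (g v) (g w)" using vw adj_verts by (auto simp: aut_adj[OF g])
    \<comment> \<open>If \<open>u'\<close> were in \<open>side w v\<close>, its image would be in
      the opposite half-tree by \<open>aut_side_mem\<close>.\<close>
    then have "u' \<in> side v w"
      using u u' aut_side_mem[OF g adj_sym[OF vw]] side_compl[OF vw] side_disjoint by blast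
    then show "u \<in> g ` side v w" using u' by blast
  qed
qed

lemma aut_convex:
  assumes g: "g \<in> automorphisms T" and S: "convex S"
  shows "convex (g ` S)"
  unfolding convex_def
proof (intro conjI ballI impI)
  show "g ` S \<subseteq> verts T" using convex_verts[OF S] aut_verts[OF g] by blast
next
  fix x y assume "x \<in> g ` S" "y \<in> g ` S" "x \<noteq> y"
  then obtain x' y' where xy: "x' \<in> S" "y' \<in> S" "x' \<noteq> y'" "x = g x'" "y = g y'" by blast
  then have "dir x y = g (dir x' y')" using aut_dir[OF g] convex_verts[OF S] by blast
  then show "dir x y \<in> g ` S" using convexD[OF S] xy by blast
qed

lemma carrier_Aut: "carrier (Aut T) = automorphisms T"
  by (simp add: Aut_def)

lemma Aut_mult:
  assumes "g \<in> automorphisms T" "h \<in> automorphisms T" "x \<in> verts T"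
  shows "(g \<otimes>\<^bsub>Aut T\<^esub> h) x = g (h x)"
  using assms by (simp add: Aut_def BijGroup_def automorphisms_def compose_eq)

lemma Aut_one: "x \<in> verts T \<Longrightarrow> \<one>\<^bsub>Aut T\<^esub> x = x"
  by (simp add: Aut_def BijGroup_def)

lemma Aut_inv:
  assumes "g \<in> automorphisms T" "x \<in> verts T"
  shows "(inv\<^bsub>Aut T\<^esub> g) (g x) = x" "g ((inv\<^bsub>Aut T\<^esub> g) x) = x"
    "inv\<^bsub>Aut T\<^esub> g \<in> automorphisms T"
proof -
  interpret group "Aut T" by (rule group_Aut)
  have g: "g \<in> carrier (Aut T)" using assms carrier_Aut by simp
  show i: "inv\<^bsub>Aut T\<^esub> g \<in> automorphisms T" using g carrier_Aut inv_closed by blast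
  show "(inv\<^bsub>Aut T\<^esub> g) (g x) = x" "g ((inv\<^bsub>Aut T\<^esub> g) x) = x"
    using Aut_mult[OF i assms(1,2)] Aut_mult[OF assms(1) i assms(2)] l_inv[OF g] r_inv[OF g]
      Aut_one[OF assms(2)] by simp_all
qed

lemma subgroup_automorphisms: "subgroup N (Aut T) \<Longrightarrow> N \<subseteq> automorphisms T"
  using subgroup.subset carrier_Aut by blast

lemma subgroup_inv_mem: "subgroup N (Aut T) \<Longrightarrow> g \<in> N \<Longrightarrow> inv\<^bsub>Aut T\<^esub> g \<in> N"
  by (rule subgroup.m_inv_closed)

lemma subgroup_mult_apply:
  assumes "subgroup N (Aut T)" "g \<in> N" "h \<in> N"
  shows "g \<otimes>\<^bsub>Aut T\<^esub> h \<in> N" "x \<in> verts T \<Longrightarrow> (g \<otimes>\<^bsub>Aut T\<^esub> h) x = g (h x)"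
  using subgroup.m_closed[OF assms] Aut_mult[of g h] subgroup_automorphisms[OF assms(1)] assms(2,3)
  by auto

lemma Aut_mult_image:
  assumes "g \<in> automorphisms T" "h \<in> automorphisms T" "A \<subseteq> verts T"
  shows "(g \<otimes>\<^bsub>Aut T\<^esub> h) ` A = g ` h ` A"
  unfolding image_image using assms by (intro image_cong) (auto simp: Aut_mult)

lemma Aut_inv_image:
  assumes "g \<in> automorphisms T" "A \<subseteq> verts T"
  shows "(inv\<^bsub>Aut T\<^esub> g) ` g ` A = A" "g ` (inv\<^bsub>Aut T\<^esub> g) ` A = A"
proof -
  have "(inv\<^bsub>Aut T\<^esub> g) (g x) = x" "g ((inv\<^bsub>Aut T\<^esub> g) x) = x" if "x \<in> A" for x
    using that assms Aut_inv by blast+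
  then show "(inv\<^bsub>Aut T\<^esub> g) ` g ` A = A" "g ` (inv\<^bsub>Aut T\<^esub> g) ` A = A"
    by (simp_all add: image_image)
qed

text \<open>Applying the inclusion to inverses gives equality. Hence \<open>dense\<close> can ask
  for inclusions only.\<close>

lemma invariant_image_eq:
  assumes N: "subgroup N (Aut T)"
    and S: "S \<subseteq> verts T" "\<And>n. n \<in> N \<Longrightarrow> n ` S \<subseteq> S" and n: "n \<in> N"
  shows "n ` S = S"
proof
  have "n ` (inv\<^bsub>Aut T\<^esub> n) ` S \<subseteq> n ` S"
    using S(2)[OF subgroup_inv_mem[OF N n]] by (rule image_mono)
  then show "S \<subseteq> n ` S"
    by (simp only: Aut_inv_image(2)[OF subsetD[OF subgroup_automorphisms[OF N] n] S(1)])
qed (rule S(2)[OF n])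

section \<open>Dense groups\<close>

text \<open>Direction functions encode ends, see \<open>fixed_end_dirfun\<close> and \<open>dirfun_fixed_end\<close>.\<close>

definition dirfun :: "('v \<Rightarrow> 'v) \<Rightarrow> bool" where
  "dirfun f \<longleftrightarrow> (\<forall>v\<in>verts T. adj T v (f v) \<and> f (f v) \<noteq> v \<and> (\<forall>w. adj T v w \<longrightarrow> f v = w \<or> f w = v))"

definition equivariant :: "('v \<Rightarrow> 'v) set \<Rightarrow> ('v \<Rightarrow> 'v) \<Rightarrow> bool" where
  "equivariant N f \<longleftrightarrow> (\<forall>g\<in>N. \<forall>v\<in>verts T. f (g v) = g (f v))"

text \<open>Geometric density with direction functions in place of ends and convex sets in place of
  subtrees; for subgroups the two notions agree by \<open>geometrically_dense_iff\<close>.\<close>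

definition dense :: "('v \<Rightarrow> 'v) set \<Rightarrow> bool" where
  "dense N \<longleftrightarrow> (\<nexists>f. dirfun f \<and> equivariant N f) \<and>
     (\<forall>S. convex S \<and> S \<noteq> {} \<and> (\<forall>g\<in>N. g ` S \<subseteq> S) \<longrightarrow> S = verts T)"

text \<open>Pairwise intersecting subtrees either have a common vertex or single out an end. In the
  first case their intersection is a non-empty invariant convex set; in the second \<open>N\<close>
  would fix the end.\<close>

lemma helly:
  assumes subgroup: "subgroup N (Aut T)" and dense: "dense N"
    and conv: "\<And>S. S \<in> F \<Longrightarrow> convex S"
    and meet: "\<And>S S'. S \<in> F \<Longrightarrow> S' \<in> F \<Longrightarrow> S \<inter> S' \<noteq> {}"
    and inv: "\<And>g S. g \<in> N \<Longrightarrow> S \<in> F \<Longrightarrow> g ` S \<in> F"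
    and S: "S \<in> F"
  shows "S = verts T"
proof (cases "\<Inter>F = {}")
  case False
  note N = subgroup_automorphisms[OF subgroup]
  have "g ` \<Inter>F \<subseteq> \<Inter>F" if g: "g \<in> N" for g
  proof
    fix y assume "y \<in> g ` \<Inter>F"
    then obtain x where x: "x \<in> \<Inter>F" "y = g x" by blast
    have "y \<in> A" if A: "A \<in> F" for A
    proof -
      have "x \<in> (inv\<^bsub>Aut T\<^esub> g) ` A" using x(1) inv[OF subgroup_inv_mem[OF subgroup g] A] by blast
      then have "y \<in> g ` (inv\<^bsub>Aut T\<^esub> g) ` A" using x(2) by blast
      then show ?thesis
        by (simp only: Aut_inv_image(2)[OF subsetD[OF N g] convex_verts[OF conv[OF A]]])
    qed
    then show "y \<in> \<Inter>F" by blast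
  qed
  then have "\<Inter>F = verts T"
    using dense False convex_Inter[of F] conv S unfolding dense_def by blast
  then show ?thesis using S convex_verts[OF conv[OF S]] by blast
next
  case True
  note N = subgroup_automorphisms[OF subgroup]
  txt \<open>Each vertex points towards a member of \<open>F\<close> avoiding it. This is well defined because the
    members meet, and it is the direction to an end.\<close>
  have "\<exists>w. adj T v w \<and> (\<forall>S\<in>F. v \<notin> S \<longrightarrow> S \<subseteq> side v w)" if v: "v \<in> verts T" for v
  proof -
    obtain S0 where S0: "S0 \<in> F" "v \<notin> S0" using True by blast
    then obtain a where a: "a \<in> S0" using meet by blast
    have "S \<subseteq> side v (dir v a)" if S: "S \<in> F" "v \<notin> S" for S
    proof -
      obtain b where b: "b \<in> S0" "b \<in> S" using meet S S0 by blast
      have "dir v a = dir v b" using convex_dir_const conv S0 v a b by blast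
      then show ?thesis using convex_subset_side[OF conv[OF S(1)] v S(2) b(2)] by simp
    qed
    moreover have "adj T v (dir v a)" using dir_adj v a S0 conv convex_verts by blast
    ultimately show ?thesis by blast
  qed
  then obtain f where f: "\<And>v. v \<in> verts T \<Longrightarrow> adj T v (f v)"
      "\<And>v S. v \<in> verts T \<Longrightarrow> S \<in> F \<Longrightarrow> v \<notin> S \<Longrightarrow> S \<subseteq> side v (f v)"
    by metis
  have miss: "\<exists>S\<in>F. v \<notin> S" for v using True by blast
  have "dirfun f"
    unfolding dirfun_def
  proof (intro ballI conjI allI impI f(1))
    fix v assume v: "v \<in> verts T"
    have fv: "f v \<in> verts T" using f(1)[OF v] adj_verts by blast
    obtain S1 S2 where S12: "S1 \<in> F" "v \<notin> S1" "S2 \<in> F" "f v \<notin> S2" using miss by meson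
    show "f (f v) \<noteq> v"
    proof
      \<comment> \<open>Members avoiding \<open>v\<close> and \<open>f v\<close> would lie on
        opposite sides of this edge.\<close>
      assume "f (f v) = v"
      then have "S1 \<subseteq> side v (f v)" "S2 \<subseteq> side (f v) v" using f(2) v fv S12 by metis+
      then show False using meet S12 side_disjoint[OF f(1)[OF v]] by blast
    qed
    fix w assume vw: "adj T v w"
    then have w: "w \<in> verts T" using adj_verts by blast
    obtain S3 where S3: "S3 \<in> F" "w \<notin> S3" using miss by meson
    show "f v = w \<or> f w = v"
    proof (rule ccontr)
      assume "\<not> ?thesis"
      \<comment> \<open>If neither endpoint points along the edge, the members \<open>S1\<close> and
        \<open>S3\<close> lie on opposite sides of it.\<close>
      then have "side v (f v) \<subseteq> side w v" "side w (f w) \<subseteq> side v w"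
        using side_subset_opposite vw adj_sym f(1) v w by metis+
      then show False
        using f(2)[OF v S12(1,2)] f(2)[OF w S3] meet[OF S12(1) S3(1)] side_disjoint[OF vw] by blast
    qed
  qed
  moreover have "equivariant N f"
    unfolding equivariant_def
  proof (intro ballI)
    fix g v assume g: "g \<in> N" and v: "v \<in> verts T"
    have ga: "g \<in> automorphisms T" using N g by blast
    have gv: "g v \<in> verts T" using aut_verts[OF ga v] .
    obtain S where S: "S \<in> F" "v \<notin> S" using miss by meson
    then obtain a where a: "a \<in> S" using meet by blast
    have SV: "S \<subseteq> verts T" using conv S convex_verts by blast
    have "g v \<notin> g ` S" using S SV v by (auto simp: aut_inj[OF ga])
    then have "g ` S \<subseteq> side (g v) (f (g v))" using f(2) gv inv g S by blast
    \<comment> \<open>The vertex \<open>g a\<close> lies behind both candidates for the direction at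
      \<open>g v\<close>, so they agree.\<close>
    then have "g a \<in> side (g v) (f (g v))" using a by blast
    moreover have "g a \<in> side (g v) (g (f v))"
      using aut_side_mem[OF ga f(1)[OF v]] f(2)[OF v S] a by blast
    moreover have "adj T (g v) (g (f v))"
      using f(1)[OF v] adj_verts by (auto simp: aut_adj[OF ga])
    ultimately show "f (g v) = g (f v)" using side_inter_eq f(1)[OF gv] by blast
  qed
  ultimately show ?thesis using dense unfolding dense_def by blast
qed

section \<open>Moving half-trees by a dense group\<close>

text \<open>The vertices whose orbit avoids the half-tree form an invariant convex set without
  \<open>d\<close>, so by density there are none.\<close>

lemma orbit_meets_side:
  assumes N: "subgroup N (Aut T)" and "dense N" and x: "x \<in> verts T" and cd: "adj T c d"
  shows "\<exists>n\<in>N. n x \<in> side c d"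
proof (rule ccontr)
  assume none: "\<not> ?thesis"
  define S where "S = {y \<in> verts T. \<forall>n\<in>N. n y \<notin> side c d}"
  have aut: "n \<in> automorphisms T" if "n \<in> N" for n using subgroup_automorphisms N that by blast
  have "convex S"
    unfolding convex_def
  proof (intro conjI ballI impI)
    fix y z assume yz: "y \<in> S" "z \<in> S" "y \<noteq> z"
    then have V: "y \<in> verts T" "z \<in> verts T" by (auto simp: S_def)
    have dV: "dir y z \<in> verts T" using dir_adj[OF V] yz adj_verts by blast
    have "n (dir y z) \<notin> side c d" if n: "n \<in> N" for n
    proof -
      have "n y \<in> side d c" "n z \<in> side d c" "n y \<noteq> n z"
        using yz n V side_compl[OF cd] aut_verts[OF aut[OF n]] aut_inj[OF aut[OF n]]
        by (auto simp: S_def)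
      then have "dir (n y) (n z) \<in> side d c" using convexD[OF convex_side[OF adj_sym[OF cd]]] by blast
      then show ?thesis using aut_dir[OF aut[OF n]] V yz side_disjoint[OF cd] by fastforce
    qed
    then show "dir y z \<in> S" using dV by (simp add: S_def)
  qed (auto simp: S_def)
  moreover have "x \<in> S" using none x by (simp add: S_def)
  moreover have "g ` S \<subseteq> S" if g: "g \<in> N" for g
  proof
    fix y assume "y \<in> g ` S"
    then obtain z where z: "z \<in> S" "y = g z" by blast
    have "n (g z) \<notin> side c d" if "n \<in> N" for n
      using subgroup_mult_apply[OF N that g] z by (metis (no_types, lifting) S_def mem_Collect_eq)
    then show "y \<in> S" using z aut_verts[OF aut[OF g]] by (simp add: S_def)
  qed
  ultimately have "S = verts T" using \<open>dense N\<close> unfolding dense_def by blast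
  then have "d \<in> S" using cd adj_verts by blast
  moreover have "\<one>\<^bsub>Aut T\<^esub> \<in> N" using N by (rule subgroup.one_closed)
  ultimately have "\<one>\<^bsub>Aut T\<^esub> d \<notin> side c d" "d \<in> verts T" by (simp_all add: S_def)
  then show False using side_self[OF cd] Aut_one by simp
qed

text \<open>Of the two half-trees at \<open>{a, b}\<close>, the one without \<open>c\<close> lies in
  a single direction from \<open>c\<close>. It contains \<open>b\<close>, or else the neighbour
  \<open>a\<close> of \<open>b\<close>, which \<open>c\<close> then sees in the same direction
  \<open>d\<close>.\<close>

lemma side_nested:
  assumes ab: "adj T a b" and cd: "adj T c d" and b: "b \<in> side c d"
  shows "side a b \<subseteq> side c d \<or> side b a \<subseteq> side c d"
proof -
  have V: "a \<in> verts T" "b \<in> verts T" "c \<in> verts T" using ab cd adj_verts by auto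
  have bc: "b \<noteq> c" "dir c b = d" using b side_not cd dir_eqI by auto
  show ?thesis
  proof (cases "c \<in> side a b")
    case True
    then have "c \<noteq> a" "c \<notin> side b a" using side_not side_disjoint ab by blast+
    moreover have "dir c a = d" using dir_step[OF adj_sym[OF ab]] bc V \<open>c \<noteq> a\<close> by metis
    ultimately show ?thesis
      using convex_subset_side[OF convex_side[OF adj_sym[OF ab]] V(3)] side_self adj_sym ab by metis
  next
    case False
    then show ?thesis
      using convex_subset_side[OF convex_side[OF ab] V(3)] side_self ab bc by metis
  qed
qed

text \<open>Otherwise all translates of the half-tree would meet one another, and
  \<open>helly\<close> would make it the whole tree.\<close>

lemma exists_disjoint_translate:
  assumes N: "subgroup N (Aut T)" and "dense N" and ab: "adj T a b"
  shows "\<exists>n\<in>N. n ` side a b \<inter> side a b = {}"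
proof (rule ccontr)
  assume none: "\<not> ?thesis"
  define F where "F = (\<lambda>n. n ` side a b) ` N"
  have NA: "N \<subseteq> automorphisms T" using subgroup_automorphisms[OF N] .
  have comp: "g ` n ` side a b = (g \<otimes>\<^bsub>Aut T\<^esub> n) ` side a b" if "g \<in> N" "n \<in> N" for g n
    by (intro Aut_mult_image[symmetric] subsetD[OF NA] that side_verts)
  have sub: "n ` side a b \<subseteq> verts T" if "n \<in> N" for n
    using that NA aut_verts subsetD[OF side_verts] by auto
  have "\<one>\<^bsub>Aut T\<^esub> \<in> N" using N by (rule subgroup.one_closed)
  moreover have "\<one>\<^bsub>Aut T\<^esub> ` side a b = side a b"
    using Aut_one subsetD[OF side_verts] by (simp cong: image_cong)
  ultimately have Y: "side a b \<in> F" unfolding F_def by force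
  have "side a b = verts T"
  proof (rule helly[OF N \<open>dense N\<close> _ _ _ Y])
    show "convex S" if "S \<in> F" for S
      using that NA aut_convex convex_side[OF ab] by (auto simp: F_def)
  next
    fix S S' assume "S \<in> F" "S' \<in> F"
    then obtain n m where nm: "n \<in> N" "m \<in> N" "S = n ` side a b" "S' = m ` side a b"
      by (auto simp: F_def)
    let ?k = "inv\<^bsub>Aut T\<^esub> m"
    have k: "?k \<in> N" using subgroup_inv_mem N nm by blast
    \<comment> \<open>The translates by \<open>n\<close> and \<open>m\<close> are compared after
      moving both by the inverse of \<open>m\<close>.\<close>
    have "(?k \<otimes>\<^bsub>Aut T\<^esub> n) ` side a b \<inter> side a b \<noteq> {}"
      using none subgroup_mult_apply(1)[OF N k nm(1)] by blast
    then obtain u v where u: "u \<in> side a b" "v \<in> side a b" "?k (n u) = v"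
      unfolding comp[OF k nm(1), symmetric] by fast
    moreover have "n u \<in> verts T" using sub[OF nm(1)] u(1) by blast
    then have "m (?k (n u)) = n u" using Aut_inv(2) nm NA by blast
    ultimately have "n u = m v" by simp
    then show "S \<inter> S' \<noteq> {}" using u nm by blast
  next
    fix g S assume g: "g \<in> N" and "S \<in> F"
    then obtain n where n: "n \<in> N" "S = n ` side a b" by (auto simp: F_def)
    then show "g ` S \<in> F"
      using subgroup_mult_apply(1)[OF N g n(1)] comp[OF g n(1)] unfolding F_def by blast
  qed
  then show False using side_not[OF ab] adj_verts[OF ab] by simp
qed

text \<open>Once \<open>b\<close> is moved into the target, \<open>side_nested\<close> puts one side
  of the moved edge inside it. If it is the wrong side, \<open>t\<close> is applied first, which
  carries \<open>side a b\<close> into \<open>side b a\<close>.\<close>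

lemma half_tree_transitive:
  assumes N: "subgroup N (Aut T)" and D: "dense N" and ab: "adj T a b" and cd: "adj T c d"
  shows "\<exists>n\<in>N. n ` side a b \<subseteq> side c d"
proof -
  obtain t where t: "t \<in> N" "t ` side a b \<inter> side a b = {}"
    using exists_disjoint_translate[OF N D ab] by blast
  obtain n where n: "n \<in> N" "n b \<in> side c d"
    using orbit_meets_side[OF N D _ cd] adj_verts ab by blast
  have na: "n \<in> automorphisms T" and ta: "t \<in> automorphisms T"
    using n t subgroup_automorphisms[OF N] by auto
  have "adj T (n a) (n b)" using ab adj_verts[OF ab] by (simp add: aut_adj[OF na])
  then consider "n ` side a b \<subseteq> side c d" | "n ` side b a \<subseteq> side c d"
    using side_nested cd n(2) aut_side_image[OF na] ab adj_sym by metis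
  then show ?thesis
  proof cases
    case 2
    have "t u \<in> side b a" if "u \<in> side a b" for u
      using t(2) that side_compl[OF ab aut_verts[OF ta side_vertsD[OF that]]] by blast
    then have "n ` t ` side a b \<subseteq> side c d" using 2 by blast
    then have "(n \<otimes>\<^bsub>Aut T\<^esub> t) ` side a b \<subseteq> side c d"
      by (simp only: Aut_mult_image[OF na ta side_verts])
    then show ?thesis using subgroup_mult_apply(1)[OF N n(1) t(1)] by (rule bexI)
  qed (use n in blast)
qed

section \<open>Two fixed ends and the line between them\<close>

definition branching :: bool where
  "branching \<longleftrightarrow> (\<exists>v w1 w2 w3. adj T v w1 \<and> adj T v w2 \<and> adj T v w3 \<and> w1 \<noteq> w2 \<and> w1 \<noteq> w3 \<and> w2 \<noteq> w3)"

text \<open>Every edge is used by \<open>f\<close> from one of its endpoints. Going outwards from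
  \<open>z\<close>, the nearer endpoint of each edge already points towards \<open>x\<close>, so the
  farther one must point back.\<close>

lemma dirfun_points_back:
  assumes f: "dirfun f" and xz: "adj T x z" and fz: "f z = x" and y: "y \<in> side x z"
  shows "f y = dir y x"
proof -
  have V: "y \<in> verts T" "x \<in> verts T" using y side_verts xz adj_verts by auto
  then have "y \<in> side x z \<longrightarrow> f y = dir y x"
  proof (induction rule: dir_induct)
    case target
    show ?case using side_not xz by blast
  next
    case (step y)
    have yd: "adj T y (dir y x)" "x \<in> side y (dir y x)" using step V dir_adj dir_side by auto
    show ?case
    proof
      assume y: "y \<in> side x z"
      show "f y = dir y x"
      proof (cases "dir y x = x")
        case True
        then have "y = z" using y yd side_iff_dir[OF xz] dir_of_adj adj_sym by metis
        then show ?thesis using fz True by simp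
      next
        case False
        then have "dir y x \<in> side x z" using side_step[OF xz y yd(1)] by blast
        then have fd: "f (dir y x) = dir (dir y x) x" using step by blast
        have "f (dir y x) \<noteq> y"
        proof
          assume "f (dir y x) = y"
          then have "x \<in> side (dir y x) y"
            using dir_side[of "dir y x" x] fd False adj_verts yd V by metis
          then show False using yd side_disjoint by blast
        qed
        then show ?thesis using f yd step unfolding dirfun_def by blast
      qed
    qed
  qed
  then show ?thesis using y by blast
qed

text \<open>The vertices where two ends lie in different directions form the line joining the ends.\<close>

lemma dirfuns_differ_convex:
  assumes f1: "dirfun f1" and f2: "dirfun f2"
  shows "convex {v \<in> verts T. f1 v \<noteq> f2 v}"
  unfolding convex_def
proof (intro conjI ballI impI)
  fix x y assume "x \<in> {v \<in> verts T. f1 v \<noteq> f2 v}" "y \<in> {v \<in> verts T. f1 v \<noteq> f2 v}" and ne: "x \<noteq> y"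
  then have x: "x \<in> verts T" "f1 x \<noteq> f2 x" and y: "y \<in> verts T" "f1 y \<noteq> f2 y" by auto
  let ?z = "dir x y"
  have z: "adj T x ?z" "y \<in> side x ?z" using dir_adj dir_side x y ne by auto
  have "f1 ?z \<noteq> f2 ?z"
  proof
    assume eq: "f1 ?z = f2 ?z"
    \<comment> \<open>At most one of the functions points from \<open>x\<close> to
      \<open>?z\<close>, so the other points from \<open>?z\<close> back to \<open>x\<close>. With
      \<open>eq\<close> both do, and then they agree at \<open>y\<close> as well.\<close>
    have "f1 ?z = x \<or> f2 ?z = x" using f1 f2 x z(1) unfolding dirfun_def by metis
    then have "f1 y = dir y x" "f2 y = dir y x" using dirfun_points_back f1 f2 z eq by metis+
    then show False using y by simp
  qed
  then show "?z \<in> {v \<in> verts T. f1 v \<noteq> f2 v}" using z adj_verts by blast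
qed auto

text \<open>The line between two distinct fixed ends would be invariant, hence all of
  \<open>T\<close>, but its vertices would have at most two neighbours. Of \<open>N\<close> only
  minimality is assumed, because the lemma serves to prove its density.\<close>

lemma equivariant_dirfun_unique:
  assumes N: "N \<subseteq> automorphisms T" and br: branching
    and min: "\<And>S. convex S \<Longrightarrow> S \<noteq> {} \<Longrightarrow> (\<And>g. g \<in> N \<Longrightarrow> g ` S \<subseteq> S) \<Longrightarrow> S = verts T"
    and f: "dirfun f1" "dirfun f2" "equivariant N f1" "equivariant N f2" and v: "v \<in> verts T"
  shows "f1 v = f2 v"
proof (rule ccontr)
  assume ne: "f1 v \<noteq> f2 v"
  let ?L = "{v \<in> verts T. f1 v \<noteq> f2 v}"
  have fV: "f1 u \<in> verts T" "f2 u \<in> verts T" if "u \<in> verts T" for u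
    using f(1,2) that adj_verts unfolding dirfun_def by blast+
  have "g ` ?L \<subseteq> ?L" if g: "g \<in> N" for g
  proof -
    have ga: "g \<in> automorphisms T" using N g by blast
    show ?thesis
      using f(3,4) g fV aut_verts[OF ga] unfolding equivariant_def by (auto simp: aut_inj[OF ga])
  qed
  then have L: "?L = verts T" using min[OF dirfuns_differ_convex[OF f(1,2)]] v ne by blast
  \<comment> \<open>At any other neighbour \<open>w\<close> both functions would point to
    \<open>u\<close>, although they differ everywhere.\<close>
  have deg: "w = f1 u \<or> w = f2 u" if uw: "adj T u w" for u w
  proof (rule ccontr)
    assume "\<not> ?thesis"
    then have "f1 w = u" "f2 w = u" using f(1,2) uw adj_verts unfolding dirfun_def by metis+
    moreover have "w \<in> ?L" using L adj_verts[OF uw] by simp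
    ultimately show False by simp
  qed
  then show False using br unfolding branching_def by metis
qed

text \<open>The vertex where the shortest path from \<open>A\<close> to \<open>B\<close> leaves \<open>A\<close>.\<close>

definition gate :: "'v set \<Rightarrow> 'v set \<Rightarrow> 'v \<Rightarrow> bool" where
  "gate A B p \<longleftrightarrow> p \<in> A \<and> (\<exists>w. w \<notin> A \<and> adj T p w \<and> B \<subseteq> side p w)"

text \<open>On the way from a vertex of \<open>A\<close> to one of \<open>B\<close>, the gate is
  where the path first steps out of \<open>A\<close>.\<close>

lemma gate_exists:
  assumes A: "convex A" "A \<noteq> {}" and B: "convex B" "B \<noteq> {}" and disj: "A \<inter> B = {}"
  shows "\<exists>p. gate A B p"
proof -
  obtain x y where xy: "x \<in> A" "y \<in> B" using A B by blast
  then have V: "x \<in> verts T" "y \<in> verts T" using A B convex_verts by blast+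
  then have "x \<in> A \<longrightarrow> ?thesis"
  proof (induction rule: dir_induct)
    case target
    show ?case using xy disj by blast
  next
    case (step x)
    show ?case
    proof (cases "dir x y \<in> A")
      case False
      have "adj T x (dir x y)" using dir_adj step V by auto
      then show ?thesis
        using False convex_subset_side[OF B(1) step(1) _ xy(2)] disj unfolding gate_def by blast
    qed (use step in blast)
  qed
  then show ?thesis using xy by blast
qed

text \<open>From \<open>q\<close>, the vertices \<open>y\<close> of \<open>B\<close>,
  \<open>w\<close> and \<open>p\<close> are all seen in the same direction. This direction is
  \<open>u\<close>, outside \<open>A\<close>, while convexity keeps the first step from
  \<open>q\<close> to \<open>p\<close> inside \<open>A\<close>.\<close>

lemma gate_unique:
  assumes A: "convex A" and B: "B \<noteq> {}" and p: "gate A B p" and q: "gate A B q"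
  shows "p = q"
proof (rule ccontr)
  assume ne: "p \<noteq> q"
  obtain w where w: "p \<in> A" "w \<notin> A" "adj T p w" "B \<subseteq> side p w" using p unfolding gate_def by blast
  obtain u where u: "q \<in> A" "u \<notin> A" "adj T q u" "B \<subseteq> side q u" using q unfolding gate_def by blast
  obtain y where y: "y \<in> side p w" "y \<in> side q u" using B w u by blast
  have qV: "q \<in> verts T" "w \<noteq> q" using u w A convex_verts by auto
  have "A \<subseteq> side w p"
    using convex_subset_side[OF A _ w(2,1)] dir_of_adj[OF adj_sym[OF w(3)]] w(3) adj_verts by auto
  then have "q \<notin> side p w" using u side_disjoint[OF w(3)] by blast
  then have "dir q y = dir q w"
    using convex_dir_const[OF convex_side[OF w(3)] qV(1)] y(1) side_self[OF w(3)] by blast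
  also have "\<dots> = dir q p" using dir_step[OF w(3) ne] qV by blast
  finally have "u = dir q p" using dir_eqI u(3) y(2) by blast
  then show False using convexD[OF A u(1) w(1)] ne u(2) by blast
qed

lemma gate_aut:
  assumes g: "g \<in> automorphisms T" and A: "convex A" "g ` A = A" and B: "g ` B = B"
    and p: "gate A B p"
  shows "gate A B (g p)"
proof -
  obtain w where w: "p \<in> A" "w \<notin> A" "adj T p w" "B \<subseteq> side p w" using p unfolding gate_def by blast
  have "g w \<notin> g ` A" using w convex_verts[OF A(1)] adj_verts by (auto simp: aut_inj[OF g])
  moreover have "adj T (g p) (g w)" using w adj_verts by (auto simp: aut_adj[OF g])
  moreover have "g ` B \<subseteq> side (g p) (g w)" using aut_side_image[OF g w(3)] w(4) by blast
  ultimately show ?thesis using A B w unfolding gate_def by auto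
qed

section \<open>Normal subgroups of dense groups\<close>

context
  fixes H N
  assumes H: "subgroup H (Aut T)" and N: "N \<lhd> Aut T\<lparr>carrier := H\<rparr>"
begin

lemma normal_subgroup: "subgroup N (Aut T)"
  using group.incl_subgroup[OF group_Aut H] normal_imp_subgroup[OF N] by blast

text \<open>Normality in pointwise form: \<open>n'\<close> is the conjugate of \<open>n\<close> by
  the inverse of \<open>h\<close>.\<close>

lemma normal_conj:
  assumes h: "h \<in> H" and n: "n \<in> N"
  shows "\<exists>n'\<in>N. \<forall>x\<in>verts T. n (h x) = h (n' x)"
proof -
  let ?h' = "inv\<^bsub>Aut T\<^esub> h"
  let ?n' = "?h' \<otimes>\<^bsub>Aut T\<^esub> n \<otimes>\<^bsub>Aut T\<^esub> h"
  have "inv\<^bsub>Aut T\<lparr>carrier := H\<rparr>\<^esub> h = ?h'" using group.m_inv_consistent[OF group_Aut H h] .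
  then have n': "?n' \<in> N" using normal.inv_op_closed1[OF N, of h n] h n by simp
  have A: "h \<in> automorphisms T" "n \<in> automorphisms T" "?h' \<in> automorphisms T"
    using h n subgroup_automorphisms[OF H] subgroup_automorphisms[OF normal_subgroup]
      subgroup_inv_mem[OF H h] by auto
  have hn: "?h' \<otimes>\<^bsub>Aut T\<^esub> n \<in> automorphisms T"
    using monoid.m_closed[OF group.is_monoid[OF group_Aut]] A carrier_Aut by blast
  have "n (h x) = h (?n' x)" if x: "x \<in> verts T" for x
    using Aut_mult[OF hn A(1) x] Aut_mult[OF A(3,2) aut_verts[OF A(1) x]]
      Aut_inv(2)[OF A(1) aut_verts[OF A(2) aut_verts[OF A(1) x]]] by simp
  then show ?thesis using n' by blast
qed

lemma normal_invariant_image: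
  assumes h: "h \<in> H" and S: "S \<subseteq> verts T" "\<And>n. n \<in> N \<Longrightarrow> n ` S \<subseteq> S" and n: "n \<in> N"
  shows "n ` h ` S \<subseteq> h ` S"
proof -
  obtain n' where n': "n' \<in> N" "\<And>x. x \<in> verts T \<Longrightarrow> n (h x) = h (n' x)"
    using normal_conj[OF h n] by blast
  have "n (h x) \<in> h ` S" if "x \<in> S" for x
    using n'(2)[of x] S(1) S(2)[OF n'(1)] that by auto
  then show ?thesis by auto
qed

text \<open>By normality \<open>H\<close> permutes the subtrees invariant under \<open>N\<close>, so
  \<open>helly\<close> applies to \<open>H\<close> once they are known to intersect
  pairwise.\<close>

lemma normal_convex_minimal:
  assumes D: "dense H" and nontriv: "N \<noteq> {\<one>\<^bsub>Aut T\<^esub>}"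
    and S: "convex S" "S \<noteq> {}" "\<And>n. n \<in> N \<Longrightarrow> n ` S \<subseteq> S"
  shows "S = verts T"
proof -
  define F where "F = {S. convex S \<and> S \<noteq> {} \<and> (\<forall>n\<in>N. n ` S \<subseteq> S)}"
  note HA = subgroup_automorphisms[OF H] and NA = subgroup_automorphisms[OF normal_subgroup]
  have F_image: "h ` A \<in> F" if h: "h \<in> H" and A: "A \<in> F" for h A
    using A aut_convex[OF subsetD[OF HA h]] normal_invariant_image[OF h] convex_verts
    by (auto simp: F_def)
  have "A \<inter> B \<noteq> {}" if A: "A \<in> F" and B: "B \<in> F" for A B
  proof
    assume disj: "A \<inter> B = {}"
    have AB: "convex A" "A \<noteq> {}" "convex B" "B \<noteq> {}"
        "\<And>n. n \<in> N \<Longrightarrow> n ` A = A" "\<And>n. n \<in> N \<Longrightarrow> n ` B = B"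
      using A B invariant_image_eq[OF normal_subgroup] convex_verts by (auto simp: F_def)
    obtain p where p: "gate A B p" using gate_exists AB(1-4) disj by blast
    let ?P = "{x \<in> verts T. \<forall>n\<in>N. n x = x}"
    \<comment> \<open>\<open>N\<close> preserves both sets, hence also their unique gate. The fixed
      vertices of \<open>N\<close> are thus a non-empty convex set, and normality makes it invariant
      under \<open>H\<close>.\<close>
    have "n p = p" if n: "n \<in> N" for n
      using gate_unique[OF AB(1,4)] gate_aut[OF subsetD[OF NA n] AB(1) AB(5)[OF n] AB(6)[OF n] p] p
      by blast
    then have "p \<in> ?P" using p AB(1) convex_verts unfolding gate_def by blast
    moreover have "convex ?P"
      unfolding convex_def
    proof (intro conjI ballI impI)
      fix x y assume xy: "x \<in> ?P" "y \<in> ?P" "x \<noteq> y"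
      then have "dir x y \<in> verts T" using dir_adj adj_verts by blast
      moreover have "n (dir x y) = dir x y" if n: "n \<in> N" for n
        using aut_dir[OF subsetD[OF NA n], of x y] xy n by force
      ultimately show "dir x y \<in> ?P" by blast
    qed auto
    moreover have "h ` ?P \<subseteq> ?P" if h: "h \<in> H" for h
    proof (intro image_subsetI CollectI conjI ballI)
      fix x assume x: "x \<in> ?P"
      then show "h x \<in> verts T" using aut_verts[OF subsetD[OF HA h]] by blast
      fix n assume "n \<in> N"
      then show "n (h x) = h x" using normal_conj[OF h] x by force
    qed
    ultimately have P: "?P = verts T" using D unfolding dense_def by blast
    have "n = \<one>\<^bsub>Aut T\<^esub>" if n: "n \<in> N" for n
    proof (rule aut_eqI)
      show "\<one>\<^bsub>Aut T\<^esub> \<in> automorphisms T" using subgroup.one_closed[OF H] HA by blast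
      show "n x = \<one>\<^bsub>Aut T\<^esub> x" if "x \<in> verts T" for x
      proof -
        have "x \<in> ?P" using P that by simp
        then show ?thesis using n Aut_one[OF that] by simp
      qed
    qed (use n NA in blast)
    then show False using nontriv subgroup.one_closed[OF normal_subgroup] by blast
  qed
  moreover have "S \<in> F" using S by (simp add: F_def)
  ultimately show ?thesis using F_image by (intro helly[OF H D, of F]) (auto simp: F_def)
qed

text \<open>\<open>f'\<close> encodes the translate by \<open>h\<close> of the end encoded by
  \<open>f\<close>. \<open>N\<close> fixes it because conjugation by \<open>h\<close> preserves
  \<open>N\<close>.\<close>

lemma conjugate_dirfun:
  assumes f: "dirfun f" "equivariant N f" and h: "h \<in> H"
  defines "f' \<equiv> \<lambda>v. h (f ((inv\<^bsub>Aut T\<^esub> h) v))"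
  shows "dirfun f'" "equivariant N f'"
proof -
  let ?k = "inv\<^bsub>Aut T\<^esub> h"
  have ha: "h \<in> automorphisms T" using h subgroup_automorphisms[OF H] by blast
  have f'h: "f' (h u) = h (f u)" if "u \<in> verts T" for u
    using Aut_inv(1)[OF ha that] by (simp add: f'_def)
  have ex: "\<exists>u\<in>verts T. v = h u" if "v \<in> verts T" for v
    using aut_image[OF ha] that by blast
  have fu: "adj T u (f u)" "f (f u) \<noteq> u" "f u \<in> verts T" "f (f u) \<in> verts T"
    if "u \<in> verts T" for u
    using f(1) that adj_verts unfolding dirfun_def by blast+
  show "dirfun f'"
    unfolding dirfun_def
  proof (intro ballI)
    fix v assume "v \<in> verts T"
    then obtain u where u: "u \<in> verts T" "v = h u" using ex by blast
    have "f' v = w \<or> f' w = v" if vw: "adj T v w" for w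
    proof -
      obtain x where x: "x \<in> verts T" "w = h x" using ex vw adj_verts by blast
      then have "adj T u x" using vw u by (simp add: aut_adj[OF ha])
      then have "f u = x \<or> f x = u" using f(1) u unfolding dirfun_def by blast
      then show ?thesis using u x f'h by auto
    qed
    then show "adj T v (f' v) \<and> f' (f' v) \<noteq> v \<and> (\<forall>w. adj T v w \<longrightarrow> f' v = w \<or> f' w = v)"
      using u f'h fu[OF u(1)] by (simp add: aut_adj[OF ha] aut_inj[OF ha])
  qed
  show "equivariant N f'"
    unfolding equivariant_def
  proof (intro ballI)
    fix n v assume n: "n \<in> N" and "v \<in> verts T"
    then obtain u where u: "u \<in> verts T" "v = h u" using ex by blast
    obtain n' where n': "n' \<in> N" "\<And>x. x \<in> verts T \<Longrightarrow> n (h x) = h (n' x)"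
      using normal_conj[OF h n] by blast
    have "n' u \<in> verts T"
      using n'(1) u subgroup_automorphisms[OF normal_subgroup] aut_verts by blast
    then have "f' (n v) = h (f (n' u))" using n'(2) u f'h by simp
    also have "\<dots> = h (n' (f u))" using f(2) n' u unfolding equivariant_def by simp
    also have "\<dots> = n (f' v)" using n'(2)[OF fu(3)] u f'h by simp
    finally show "f' (n v) = n (f' v)" .
  qed
qed

text \<open>By uniqueness, an end fixed by \<open>N\<close> coincides with its translates under
  \<open>H\<close>, so \<open>H\<close> would fix it too.\<close>

lemma normal_dense:
  assumes D: "dense H" and nontriv: "N \<noteq> {\<one>\<^bsub>Aut T\<^esub>}" and br: branching
  shows "dense N"
proof -
  have min: "S = verts T" if "convex S" "S \<noteq> {}" "\<And>n. n \<in> N \<Longrightarrow> n ` S \<subseteq> S" for S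
    using normal_convex_minimal[OF D nontriv that] .
  have False if f: "dirfun f" "equivariant N f" for f
  proof -
    have "f (h u) = h (f u)" if h: "h \<in> H" and u: "u \<in> verts T" for h u
    proof -
      have ha: "h \<in> automorphisms T" using h subgroup_automorphisms[OF H] by blast
      have "f (h u) = h (f ((inv\<^bsub>Aut T\<^esub> h) (h u)))"
        by (rule equivariant_dirfun_unique[OF subgroup_automorphisms[OF normal_subgroup] br min
              f(1) conjugate_dirfun(1)[OF f h] f(2) conjugate_dirfun(2)[OF f h]])
          (use aut_verts[OF ha u] in auto)
      then show ?thesis using Aut_inv(1)[OF ha u] by simp
    qed
    then show False using D f(1) unfolding dense_def equivariant_def by blast
  qed
  then show ?thesis using min unfolding dense_def by blast
qed

end

section \<open>Subtrees, ends and geometric density\<close>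

lemma subtree_adj:
  assumes "subtree S T" "adj S x y"
  shows "adj T x y" "x \<in> verts S" "y \<in> verts S"
  using assms unfolding subtree_def is_tree_def simple_graph_def adj_def
  by (fastforce simp: doubleton_eq_iff)+

lemma subtree_reach:
  assumes "subtree S T" "x \<in> verts S" "y \<in> verts S"
  shows "(adj S)\<^sup>*\<^sup>* x y"
  using assms unfolding subtree_def is_tree_def connected_graph_def by blast

lemma subtree_convex:
  assumes S: "subtree S T"
  shows "convex (verts S)"
proof (rule connected_convex)
  show "verts S \<subseteq> verts T" using S by (simp add: subtree_def)
  show "(\<lambda>a b. a \<in> verts S \<and> b \<in> verts S \<and> adj T a b)\<^sup>*\<^sup>* x y"
    if "x \<in> verts S" "y \<in> verts S" for x y
    by (rule mono_rtranclp[rule_format, OF _ subtree_reach[OF S that]]) (use subtree_adj[OF S] in blast)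
qed

text \<open>Every edge of \<open>T\<close> is a bridge, so a connected subgraph on all vertices
  cannot omit it.\<close>

lemma spanning_subtree:
  assumes S: "subtree S T" and V: "verts S = verts T"
  shows "S = T"
proof -
  have "edges T \<subseteq> edges S"
  proof
    fix e assume e: "e \<in> edges T"
    then obtain x y where xy: "adj T x y" "e = {x, y}" using edgeE by blast
    show "e \<in> edges S"
    proof (rule ccontr)
      assume "e \<notin> edges S"
      then have "adj S a b \<longrightarrow> adj (remove_edge T {x, y}) a b" for a b
        using subtree_adj(1)[OF S, of a b] xy by (auto simp: adj_def remove_edge_def)
      moreover have "(adj S)\<^sup>*\<^sup>* y x" using subtree_reach[OF S] V adj_verts[OF xy(1)] by blast
      ultimately show False using bridge[OF xy(1)] mono_rtranclp by metis
    qed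
  qed
  then show ?thesis using S V by (intro ugraph.equality) (auto simp: subtree_def)
qed

lemma convex_subtree:
  assumes S: "convex S" "S \<noteq> {}"
  shows "subtree \<lparr>verts = S, edges = {e \<in> edges T. e \<subseteq> S}\<rparr> T"
proof -
  let ?S = "\<lparr>verts = S, edges = {e \<in> edges T. e \<subseteq> S}\<rparr>"
  have adj: "adj ?S a b \<longleftrightarrow> a \<in> S \<and> b \<in> S \<and> adj T a b" for a b
    by (auto simp: adj_def)
  have "simple_graph ?S"
    unfolding simple_graph_def
  proof
    fix e assume e: "e \<in> edges ?S"
    then obtain x y where "adj T x y" "e = {x, y}" using edgeE by auto
    then show "\<exists>x\<in>verts ?S. \<exists>y\<in>verts ?S. x \<noteq> y \<and> e = {x, y}"
      using e adj_verts[of x y] by (intro bexI[of _ x] bexI[of _ y]) auto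
  qed
  moreover have "adj ?S = (\<lambda>a b. a \<in> S \<and> b \<in> S \<and> adj T a b)" using adj by blast
  then have "connected_graph ?S"
    using S convex_connected[OF S(1)] by (simp add: connected_graph_def)
  moreover have "\<not> graph_cycle ?S xs" for xs
  proof
    assume "graph_cycle ?S xs"
    then have "graph_cycle T xs"
      unfolding graph_cycle_def adj by (auto elim: successively_mono)
    then show False using tree unfolding is_tree_def by blast
  qed
  ultimately show ?thesis using convex_verts[OF S(1)] by (auto simp: subtree_def is_tree_def)
qed

lemma graph_image_induced:
  assumes g: "g \<in> automorphisms T" and S: "S \<subseteq> verts T" "g ` S = S"
  shows "graph_image g \<lparr>verts = S, edges = {e \<in> edges T. e \<subseteq> S}\<rparr>
    = \<lparr>verts = S, edges = {e \<in> edges T. e \<subseteq> S}\<rparr>"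
proof -
  let ?E = "{e \<in> edges T. e \<subseteq> S}"
  have "(`) g ` ?E = ?E"
  proof
    show "(`) g ` ?E \<subseteq> ?E"
    proof
      fix e' assume "e' \<in> (`) g ` ?E"
      then obtain e where e: "e \<in> edges T" "e \<subseteq> S" "e' = g ` e" by blast
      obtain x y where xy: "adj T x y" "e = {x, y}" using edgeE e(1) by blast
      then have "adj T (g x) (g y)" using adj_verts by (simp add: aut_adj[OF g])
      then show "e' \<in> ?E" using e xy S by (auto simp: adj_def)
    qed
    show "?E \<subseteq> (`) g ` ?E"
    proof
      fix e assume e: "e \<in> ?E"
      then obtain x y where xy: "adj T x y" "e = {x, y}" using edgeE by auto
      then have "x \<in> g ` S" "y \<in> g ` S" using e S(2) by auto
      then obtain x' y' where x': "x' \<in> S" "y' \<in> S" "x = g x'" "y = g y'" by blast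
      then have "adj T x' y'" using xy aut_adj[OF g, of x' y'] S by blast
      then show "e \<in> (`) g ` ?E" using x' xy by (intro image_eqI[of _ _ "{x', y'}"]) (auto simp: adj_def)
    qed
  qed
  then show ?thesis using S by (simp add: graph_image_def)
qed

section \<open>Walks without backtracking, rays and directions to ends\<close>

text \<open>To come back over an edge the walk must first return to \<open>r (Suc n)\<close> and
  turn back there. The induction hypothesis for the next edge forbids a later return, which is why
  \<open>n\<close> is arbitrary in the induction.\<close>

lemma walk_side:
  assumes adj: "\<And>n. adj T (r n) (r (Suc n))" and nb: "\<And>n. r (Suc (Suc n)) \<noteq> r n"
  shows "r (Suc n + j) \<in> side (r n) (r (Suc n))"
proof (induction j arbitrary: n rule: less_induct)
  case (less j)
  show ?case
  proof (cases j)
    case 0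
    then show ?thesis using side_self[OF adj] by simp
  next
    case (Suc i)
    then have i: "r (Suc n + i) \<in> side (r n) (r (Suc n))" using less by simp
    have "\<not> (r (Suc n + i) = r (Suc n) \<and> r (Suc n + j) = r n)"
    proof (cases i)
      case 0
      then show ?thesis using nb Suc by simp
    next
      case (Suc l)
      then have "r (Suc (Suc n) + l) \<in> side (r (Suc n)) (r (Suc (Suc n)))"
        using less.IH[of l "Suc n"] Suc \<open>j = Suc i\<close> by simp
      then show ?thesis using side_not[OF adj] Suc by fastforce
    qed
    then show ?thesis using side_step[OF adj i, of "r (Suc n + j)"] adj Suc by auto
  qed
qed

lemma walk_ray:
  assumes adj: "\<And>n. adj T (r n) (r (Suc n))" and nb: "\<And>n. r (Suc (Suc n)) \<noteq> r n"
  shows "r \<in> rays T"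
proof -
  have "r m \<noteq> r n" if "n < m" for m n
  proof -
    have "r m \<in> side (r n) (r (Suc n))"
      using walk_side[of r n "m - Suc n"] adj nb that by simp
    then show ?thesis using side_not[OF adj[of n]] by metis
  qed
  then have "inj r" by (metis injI linorder_neqE_nat)
  then show ?thesis using adj by (simp add: rays_def)
qed

lemma rays_adj: "r \<in> rays T \<Longrightarrow> adj T (r n) (r (Suc n))"
  and rays_inj: "r \<in> rays T \<Longrightarrow> r m = r n \<longleftrightarrow> m = n"
  by (auto simp: rays_def inj_eq)

lemma rays_verts: "r \<in> rays T \<Longrightarrow> r n \<in> verts T"
  using rays_adj adj_verts by blast

definition end_dir :: "(nat \<Rightarrow> 'v) \<Rightarrow> 'v \<Rightarrow> 'v" where
  "end_dir r v = (THE w. adj T v w \<and> (\<exists>m. \<forall>k\<ge>m. r k \<in> side v w))"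

lemma end_dir_eqI:
  assumes "adj T v w" "\<And>k. m \<le> k \<Longrightarrow> r k \<in> side v w"
  shows "end_dir r v = w"
  unfolding end_dir_def
proof (rule the_equality)
  show "adj T v w \<and> (\<exists>m. \<forall>k\<ge>m. r k \<in> side v w)" using assms by blast
next
  fix u assume "adj T v u \<and> (\<exists>m. \<forall>k\<ge>m. r k \<in> side v u)"
  then obtain l where l: "adj T v u" "\<And>k. l \<le> k \<Longrightarrow> r k \<in> side v u" by blast
  then have "r (max l m) \<in> side v u" "r (max l m) \<in> side v w" using assms by auto
  then show "u = w" using side_inter_eq l assms by blast
qed

text \<open>An injective ray visits \<open>v\<close> at most once. After that visit its direction
  from \<open>v\<close> stays constant.\<close>

lemma end_dir_exists:
  assumes r: "r \<in> rays T" and v: "v \<in> verts T"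
  shows "adj T v (end_dir r v)" "\<exists>m. \<forall>k\<ge>m. r k \<in> side v (end_dir r v)"
proof -
  obtain m where m: "\<And>k. m \<le> k \<Longrightarrow> r k \<noteq> v"
  proof (cases "\<exists>m. r m = v")
    case True
    then obtain m where "r m = v" by blast
    then show ?thesis using that[of "Suc m"] rays_inj[OF r] by (metis not_less_eq_eq order_refl)
  qed blast
  have const: "dir v (r k) = dir v (r m)" if "m \<le> k" for k
    using that
  proof (induction rule: dec_induct)
    case (step k)
    then show ?case using dir_step[OF rays_adj[OF r] m m v, of k] by simp
  qed simp
  have s: "r k \<in> side v (dir v (r m))" if "m \<le> k" for k
    using dir_side[OF v rays_verts[OF r] m[OF that]] const[OF that] by simp
  have a: "adj T v (dir v (r m))" using dir_adj[OF v rays_verts[OF r] m] by simp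
  have "end_dir r v = dir v (r m)" by (rule end_dir_eqI[OF a s])
  then show "adj T v (end_dir r v)" "\<exists>m. \<forall>k\<ge>m. r k \<in> side v (end_dir r v)"
    using a s by metis+
qed

lemma dirfun_end_dir:
  assumes r: "r \<in> rays T"
  shows "dirfun (end_dir r)"
  unfolding dirfun_def
proof (intro ballI conjI allI impI end_dir_exists(1)[OF r])
  fix v assume v: "v \<in> verts T"
  let ?w = "end_dir r v"
  have vw: "adj T v ?w" using end_dir_exists(1)[OF r v] .
  obtain m where m: "\<And>k. m \<le> k \<Longrightarrow> r k \<in> side v ?w" using end_dir_exists(2)[OF r v] by blast
  obtain l where l: "\<And>k. l \<le> k \<Longrightarrow> r k \<in> side ?w (end_dir r ?w)"
    using end_dir_exists(2)[OF r, of ?w] adj_verts[OF vw] by blast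
  have "r (max l m) \<in> side v ?w" "r (max l m) \<in> side ?w (end_dir r ?w)" using m l by auto
  then show "end_dir r ?w \<noteq> v" using side_disjoint[OF vw] by auto
  fix u assume vu: "adj T v u"
  show "?w = u \<or> end_dir r u = v"
  proof (rule disjCI)
    assume "end_dir r u \<noteq> v"
    show "?w = u"
    proof (rule ccontr)
      assume "?w \<noteq> u"
      then have "side v ?w \<subseteq> side u v" using side_subset_opposite[OF vu vw] by blast
      then have "end_dir r u = v" using m by (intro end_dir_eqI[OF adj_sym[OF vu], of m]) blast
      then show False using \<open>end_dir r u \<noteq> v\<close> by blast
    qed
  qed
qed

lemma end_dir_equiv:
  assumes rs: "(r, s) \<in> ray_equiv T" and v: "v \<in> verts T"
  shows "end_dir s v = end_dir r v"
proof -
  obtain m n where rsV: "r \<in> rays T" "s \<in> rays T" and eq: "\<And>k. r (m + k) = s (n + k)"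
    using rs by (auto simp: ray_equiv_def)
  obtain l where l: "\<And>k. l \<le> k \<Longrightarrow> r k \<in> side v (end_dir r v)"
    using end_dir_exists(2)[OF rsV(1) v] by blast
  show ?thesis
  \<comment> \<open>From index \<open>n + l\<close> on, \<open>s\<close> runs through vertices
    \<open>r (m + (k - n))\<close>, whose index is at least \<open>l\<close>.\<close>
  proof (rule end_dir_eqI[OF end_dir_exists(1)[OF rsV(1) v], of "n + l"])
    fix k assume k: "n + l \<le> k"
    then have "s k = r (m + (k - n))" using eq[of "k - n"] by simp
    then show "s k \<in> side v (end_dir r v)" using l k by simp
  qed
qed

lemma ray_aut:
  assumes g: "g \<in> automorphisms T" and r: "r \<in> rays T"
  shows "g \<circ> r \<in> rays T"
  using r aut_adj[OF g] aut_inj[OF g] rays_verts[OF r] by (simp add: rays_def inj_on_def)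

lemma end_dir_aut:
  assumes g: "g \<in> automorphisms T" and r: "r \<in> rays T" and v: "v \<in> verts T"
  shows "end_dir (g \<circ> r) (g v) = g (end_dir r v)"
proof -
  have vw: "adj T v (end_dir r v)" using end_dir_exists(1)[OF r v] .
  obtain m where m: "\<And>k. m \<le> k \<Longrightarrow> r k \<in> side v (end_dir r v)"
    using end_dir_exists(2)[OF r v] by blast
  show ?thesis
  proof (rule end_dir_eqI)
    show "adj T (g v) (g (end_dir r v))" using vw adj_verts[OF vw] by (simp add: aut_adj[OF g])
    show "(g \<circ> r) k \<in> side (g v) (g (end_dir r v))" if "m \<le> k" for k
      using aut_side_mem[OF g vw m[OF that]] by simp
  qed
qed

text \<open>The directions to one ray of the end serve as \<open>f\<close>. They do not depend on
  the choice: \<open>g \<circ> r\<close> belongs to the same end and gives the same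
  directions.\<close>

lemma fixed_end_dirfun:
  assumes N: "N \<subseteq> automorphisms T" and e: "\<xi> \<in> ends T" and fixed: "fixes_end N \<xi>"
  shows "\<exists>f. dirfun f \<and> equivariant N f"
proof -
  obtain r where r: "r \<in> rays T" "\<xi> = ray_equiv T `` {r}" using e by (auto simp: ends_def elim: quotientE)
  have "(r, r) \<in> ray_equiv T" using r by (auto simp: ray_equiv_def)
  then have "r \<in> \<xi>" using r by simp
  then have gr: "(r, g \<circ> r) \<in> ray_equiv T" if "g \<in> N" for g
    using fixed that r unfolding fixes_end_def by blast
  have "equivariant N (end_dir r)"
    unfolding equivariant_def
  proof (intro ballI)
    fix g v assume g: "g \<in> N" and v: "v \<in> verts T"
    then have ga: "g \<in> automorphisms T" using N by blast
    show "end_dir r (g v) = g (end_dir r v)"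
      using end_dir_equiv[OF gr[OF g] aut_verts[OF ga v]] end_dir_aut[OF ga r(1) v] by simp
  qed
  then show ?thesis using dirfun_end_dir[OF r(1)] by blast
qed

text \<open>Of two neighbours one is the value of \<open>f\<close> at the other, so their orbits
  under \<open>f\<close> merge; a path transports this to any two vertices. Hence \<open>f\<close>
  determines a single end.\<close>

lemma dirfun_merge:
  assumes f: "dirfun f" and "u \<in> verts T" "v \<in> verts T"
  shows "\<exists>p q. (f ^^ p) u = (f ^^ q) v"
  using reach[OF assms(2,3)]
proof (induction rule: rtranclp_induct)
  case base
  show ?case by blast
next
  case (step v w)
  then obtain p q where pq: "(f ^^ p) u = (f ^^ q) v" by blast
  consider "f v = w" | "f w = v" using f step(2) adj_verts unfolding dirfun_def by blast
  then show ?case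
  proof cases
    case 1
    have "(f ^^ Suc p) u = (f ^^ q) w" using pq 1 by (metis comp_apply funpow_Suc_right funpow.simps(2))
    then show ?thesis by blast
  next
    case 2
    have "(f ^^ p) u = (f ^^ Suc q) w" using pq 2 by (simp add: funpow_Suc_right del: funpow.simps)
    then show ?thesis by blast
  qed
qed

lemma dirfun_fixed_end:
  assumes N: "subgroup N (Aut T)" and f: "dirfun f" and eqv: "equivariant N f"
  shows "\<exists>\<xi>. \<xi> \<in> ends T \<and> fixes_end N \<xi>"
proof -
  obtain v where v: "v \<in> verts T" using verts_nonempty by blast
  \<comment> \<open>The orbit of \<open>f\<close> is a ray because \<open>f\<close> never turns
    back.\<close>
  define r where "r n = (f ^^ n) v" for n
  have rV: "r n \<in> verts T" for n
    using v f adj_verts unfolding r_def dirfun_def by (induction n) auto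
  have r: "r \<in> rays T"
    using f rV unfolding dirfun_def by (intro walk_ray) (simp_all add: r_def)
  define \<xi> where "\<xi> = ray_equiv T `` {r}"
  \<comment> \<open>The end consists of the rays that eventually follow \<open>f\<close>. This
    description does not mention \<open>r\<close> and is preserved by any automorphism that commutes
    with \<open>f\<close>.\<close>
  have mem: "s \<in> \<xi> \<longleftrightarrow> s \<in> rays T \<and> (\<exists>m. \<forall>k\<ge>m. s (Suc k) = f (s k))" for s
  proof
    assume "s \<in> \<xi>"
    then obtain m n where s: "s \<in> rays T" and eq: "\<And>k. r (m + k) = s (n + k)"
      by (auto simp: \<xi>_def ray_equiv_def)
    have "s (Suc k) = f (s k)" if "n \<le> k" for k
      using eq[of "k - n"] eq[of "Suc (k - n)"] that by (simp add: r_def)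
    then show "s \<in> rays T \<and> (\<exists>m. \<forall>k\<ge>m. s (Suc k) = f (s k))" using s by blast
  next
    assume "s \<in> rays T \<and> (\<exists>m. \<forall>k\<ge>m. s (Suc k) = f (s k))"
    then obtain m where s: "s \<in> rays T" and m: "\<And>k. m \<le> k \<Longrightarrow> s (Suc k) = f (s k)" by blast
    obtain p q where pq: "(f ^^ p) v = (f ^^ q) (s m)"
      using dirfun_merge[OF f v rays_verts[OF s]] by blast
    have iter: "s (m + k) = (f ^^ k) (s m)" for k
      by (induction k) (simp_all add: m)
    have "r (p + k) = s (m + q + k)" for k
    proof -
      have "r (p + k) = (f ^^ k) ((f ^^ q) (s m))"
        unfolding r_def pq[symmetric] by (metis add.commute comp_apply funpow_add)
      then show ?thesis using iter[of "q + k"] by (metis add.assoc add.commute comp_apply funpow_add)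
    qed
    then show "s \<in> \<xi>" using r s unfolding \<xi>_def ray_equiv_def by blast
  qed
  have img: "g \<circ> s \<in> \<xi>" if g: "g \<in> N" and s: "s \<in> \<xi>" for g s
  proof -
    have ga: "g \<in> automorphisms T" using g subgroup_automorphisms[OF N] by blast
    obtain m where m: "s \<in> rays T" "\<And>k. m \<le> k \<Longrightarrow> s (Suc k) = f (s k)" using mem s by blast
    then have "(g \<circ> s) (Suc k) = f ((g \<circ> s) k)" if "m \<le> k" for k
      using that eqv g rays_verts[OF m(1)] unfolding equivariant_def by simp
    then show ?thesis using mem ray_aut[OF ga m(1)] by blast
  qed
  have "s \<in> (\<lambda>r. g \<circ> r) ` \<xi>" if g: "g \<in> N" and s: "s \<in> \<xi>" for g s
  proof (rule image_eqI)
    have "g \<in> automorphisms T" using g subgroup_automorphisms[OF N] by blast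
    then show "s = g \<circ> (inv\<^bsub>Aut T\<^esub> g \<circ> s)"
      using Aut_inv(2)[of g] rays_verts[of s] mem s by (simp add: fun_eq_iff)
    show "inv\<^bsub>Aut T\<^esub> g \<circ> s \<in> \<xi>" by (rule img[OF subgroup_inv_mem[OF N g] s])
  qed
  then have "fixes_end N \<xi>"
    using img unfolding fixes_end_def by blast
  moreover have "\<xi> \<in> ends T" using r by (simp add: ends_def \<xi>_def quotientI)
  ultimately show ?thesis by blast
qed

text \<open>A non-empty convex set induces a subtree, and by \<open>spanning_subtree\<close> a
  subtree on all vertices is \<open>T\<close>; so both minimality conditions agree.\<close>

lemma geometrically_dense_iff:
  assumes N: "subgroup N (Aut T)"
  shows "geometrically_dense T N \<longleftrightarrow> dense N"
proof
  note NA = subgroup_automorphisms[OF N]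
  assume D: "geometrically_dense T N"
  have "S = verts T" if S: "convex S" "S \<noteq> {}" "\<And>g. g \<in> N \<Longrightarrow> g ` S \<subseteq> S" for S
  proof -
    have SV: "S \<subseteq> verts T" using convex_verts[OF S(1)] .
    have "g ` S = S" if "g \<in> N" for g using invariant_image_eq[OF N SV S(3) that] .
    then have "\<forall>g\<in>N. graph_image g \<lparr>verts = S, edges = {e \<in> edges T. e \<subseteq> S}\<rparr>
        = \<lparr>verts = S, edges = {e \<in> edges T. e \<subseteq> S}\<rparr>"
      using graph_image_induced[OF subsetD[OF NA] SV] by blast
    then have "\<lparr>verts = S, edges = {e \<in> edges T. e \<subseteq> S}\<rparr> = T"
      using D convex_subtree[OF S(1,2)] unfolding geometrically_dense_def by blast
    then show ?thesis by (metis ugraph.select_convs(1))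
  qed
  moreover have "\<not> (dirfun f \<and> equivariant N f)" for f
    using D dirfun_fixed_end[OF N, of f] unfolding geometrically_dense_def by blast
  ultimately show "dense N" unfolding dense_def by blast
next
  assume D: "dense N"
  have "S = T" if S: "subtree S T" "\<forall>g\<in>N. graph_image g S = S" for S
  proof (rule spanning_subtree[OF S(1)])
    have "g ` verts S \<subseteq> verts S" if "g \<in> N" for g
    proof -
      have "verts (graph_image g S) = verts S" using S(2) that by simp
      then show ?thesis by (simp add: graph_image_def)
    qed
    moreover have "verts S \<noteq> {}"
      using S(1) by (auto simp: subtree_def is_tree_def connected_graph_def)
    ultimately show "verts S = verts T"
      using D subtree_convex[OF S(1)] unfolding dense_def by simp
  qed
  moreover have "\<not> (\<xi> \<in> ends T \<and> fixes_end N \<xi>)" for \<xi>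
    using D fixed_end_dirfun[OF subgroup_automorphisms[OF N], of \<xi>] unfolding dense_def by blast
  ultimately show "geometrically_dense T N" unfolding geometrically_dense_def by blast
qed

section \<open>Rigid stabilisers\<close>

lemma half_treesD:
  assumes "Y \<in> half_trees T"
  shows "\<exists>a b. adj T a b \<and> Y = side a b"
proof -
  obtain e where e: "e \<in> edges T" "Y \<in> components (remove_edge T e)"
    using assms by (auto simp: half_trees_def)
  obtain a b where ab: "adj T a b" "e = {a, b}" using edgeE e(1) by blast
  obtain x where x: "x \<in> verts T" "Y = {y \<in> verts T. (adj (remove_edge T e))\<^sup>*\<^sup>* x y}"
    using e(2) by (auto simp: components_def remove_edge_def)
  have "Y = side c d" if "x \<in> side c d" "e = {c, d}" for c d
  proof -
    have "(adj (remove_edge T e))\<^sup>*\<^sup>* d x" using that by (simp add: side_def)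
    then have "(adj (remove_edge T e))\<^sup>*\<^sup>* x y \<longleftrightarrow> (adj (remove_edge T e))\<^sup>*\<^sup>* d y" for y
      using reach_remove_edge_sym rtranclp_trans by metis
    then show ?thesis using x that by (simp add: side_def)
  qed
  then show ?thesis using side_compl[OF ab(1) x(1)] ab adj_sym by (metis insert_commute)
qed

lemma side_half_tree:
  assumes "adj T a b" shows "side a b \<in> half_trees T"
  using assms adj_verts[OF assms]
  by (auto simp: half_trees_def components_def side_def remove_edge_def adj_def)

definition fixes_outside :: "('v \<Rightarrow> 'v) \<Rightarrow> 'v set \<Rightarrow> bool" where
  "fixes_outside g A \<longleftrightarrow> (\<forall>x\<in>verts T - A. g x = x)"

lemma rist_half_treeE:
  assumes "a \<in> (\<Union>Y\<in>half_trees T. rist T H Y)"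
  obtains x y where "adj T x y" "a \<in> H" "fixes_outside a (side x y)"
proof -
  obtain Y where Y: "Y \<in> half_trees T" "a \<in> rist T H Y" using assms by (rule UN_E)
  obtain x y where "adj T x y" "Y = side x y" using half_treesD[OF Y(1)] by blast
  then show ?thesis using that Y(2) by (simp add: rist_def fixes_outside_def)
qed

lemma rist_iff: "g \<in> rist T H A \<longleftrightarrow> g \<in> H \<and> fixes_outside g A"
  by (simp add: rist_def fixes_outside_def)

lemma one_automorphism: "\<one>\<^bsub>Aut T\<^esub> \<in> automorphisms T"
  using monoid.one_closed[OF group.is_monoid[OF group_Aut]] carrier_Aut by blast

lemma mult_automorphism:
  "g \<in> automorphisms T \<Longrightarrow> h \<in> automorphisms T \<Longrightarrow> g \<otimes>\<^bsub>Aut T\<^esub> h \<in> automorphisms T"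
  using monoid.m_closed[OF group.is_monoid[OF group_Aut]] carrier_Aut by blast

lemma fixes_outside_commute:
  assumes a: "a \<in> automorphisms T" "fixes_outside a A"
    and b: "b \<in> automorphisms T" "fixes_outside b B" and disj: "A \<inter> B = {}"
  shows "a \<otimes>\<^bsub>Aut T\<^esub> b = b \<otimes>\<^bsub>Aut T\<^esub> a"
proof (rule aut_eqI[OF mult_automorphism[OF a(1) b(1)] mult_automorphism[OF b(1) a(1)]])
  fix x assume x: "x \<in> verts T"
  \<comment> \<open>If \<open>c x\<close> were outside \<open>C\<close>, it would be fixed by
    \<open>c\<close>, and injectivity would give \<open>c x = x\<close>.\<close>
  have stay: "c x \<in> C" if "c \<in> automorphisms T" "fixes_outside c C" "x \<in> C" for c C
    using that x aut_verts[OF that(1) x] aut_inj[OF that(1) aut_verts[OF that(1) x] x]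
    unfolding fixes_outside_def by (metis DiffI)
  have "a (b x) = b (a x)"
    using stay[OF a] stay[OF b] a(2) b(2) disj x aut_verts[OF a(1) x] aut_verts[OF b(1) x]
    unfolding fixes_outside_def by (metis DiffI disjoint_iff)
  then show "(a \<otimes>\<^bsub>Aut T\<^esub> b) x = (b \<otimes>\<^bsub>Aut T\<^esub> a) x" using Aut_mult a b x by simp
qed

lemma fixes_outside_disjoint:
  assumes "a \<in> automorphisms T" "fixes_outside a A" "fixes_outside a B" "A \<inter> B = {}"
  shows "a = \<one>\<^bsub>Aut T\<^esub>"
proof (rule aut_eqI[OF assms(1) one_automorphism])
  fix x assume x: "x \<in> verts T"
  then have "a x = x" using assms unfolding fixes_outside_def by blast
  then show "a x = \<one>\<^bsub>Aut T\<^esub> x" using Aut_one x by simp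
qed

lemma fixes_outside_conj:
  assumes g: "g \<in> automorphisms T" and a: "a \<in> automorphisms T" "fixes_outside a A"
  shows "fixes_outside (g \<otimes>\<^bsub>Aut T\<^esub> a \<otimes>\<^bsub>Aut T\<^esub> inv\<^bsub>Aut T\<^esub> g) (g ` A)"
  unfolding fixes_outside_def
proof
  fix x assume x: "x \<in> verts T - g ` A"
  let ?k = "inv\<^bsub>Aut T\<^esub> g"
  have xV: "x \<in> verts T" using x by blast
  have k: "?k \<in> automorphisms T" "g (?k x) = x" using Aut_inv[OF g xV] by auto
  have kV: "?k x \<in> verts T" using aut_verts[OF k(1) xV] .
  then have "a (?k x) = ?k x" using a(2) x k(2) unfolding fixes_outside_def by force
  then show "(g \<otimes>\<^bsub>Aut T\<^esub> a \<otimes>\<^bsub>Aut T\<^esub> ?k) x = x"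
    using Aut_mult[OF mult_automorphism[OF g a(1)] k(1) xV] Aut_mult[OF g a(1) kV] k(2) by simp
qed

lemma conj_eq_one:
  assumes "g \<in> automorphisms T" "a \<in> automorphisms T"
    "g \<otimes>\<^bsub>Aut T\<^esub> a \<otimes>\<^bsub>Aut T\<^esub> inv\<^bsub>Aut T\<^esub> g = \<one>\<^bsub>Aut T\<^esub>"
  shows "a = \<one>\<^bsub>Aut T\<^esub>"
proof -
  interpret group "Aut T" by (rule group_Aut)
  have c: "g \<in> carrier (Aut T)" "a \<in> carrier (Aut T)" using assms carrier_Aut by auto
  then have "g \<otimes>\<^bsub>Aut T\<^esub> a = g" using assms(3) inv_solve_right'[of "\<one>\<^bsub>Aut T\<^esub>" "g \<otimes>\<^bsub>Aut T\<^esub> a" g] by simp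
  then show ?thesis using c by simp
qed

section \<open>The subgroup generated by the rigid stabilisers of half-trees\<close>

lemma plusplus_nontrivial:
  assumes H: "subgroup H (Aut T)" and pp: "plusplus T H \<noteq> {\<one>\<^bsub>Aut T\<^esub>}"
  obtains x y a where "adj T x y" "a \<in> rist T H (side x y)" "a \<noteq> \<one>\<^bsub>Aut T\<^esub>"
proof -
  interpret group "Aut T" by (rule group_Aut)
  have "\<exists>Y\<in>half_trees T. \<exists>a\<in>rist T H Y. a \<noteq> \<one>\<^bsub>Aut T\<^esub>"
  proof (rule ccontr)
    assume "\<not> ?thesis"
    then have "plusplus T H \<subseteq> generate (Aut T) {\<one>\<^bsub>Aut T\<^esub>}"
      unfolding plusplus_def by (intro mono_generate) blast
    moreover have "\<one>\<^bsub>Aut T\<^esub> \<in> plusplus T H" unfolding plusplus_def by (rule generate.one)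
    ultimately show False using pp generate_one by auto
  qed
  then show ?thesis using that half_treesD by blast
qed

lemma plusplus_incl:
  assumes H: "subgroup H (Aut T)" shows "plusplus T H \<subseteq> H"
  unfolding plusplus_def
  by (rule group.generate_subgroup_incl[OF group_Aut _ H]) (auto simp: rist_def)

lemma plusplus_mem:
  "adj T x y \<Longrightarrow> a \<in> rist T H (side x y) \<Longrightarrow> a \<in> plusplus T H"
  unfolding plusplus_def using side_half_tree by (blast intro: generate.incl)

text \<open>On the way from a moved vertex to the fixed vertex \<open>x\<close> there is a moved
  \<open>w\<close> followed by a fixed vertex. This fixed vertex has the neighbours
  \<open>w\<close>, \<open>a w\<close> and the next vertex towards \<open>x\<close>.\<close>

lemma branching_if_rist:
  assumes H: "subgroup H (Aut T)" and xy: "adj T x y"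
    and a: "a \<in> rist T H (side x y)" "a \<noteq> \<one>\<^bsub>Aut T\<^esub>"
  shows branching
proof -
  have aa: "a \<in> automorphisms T" and fixed: "fixes_outside a (side x y)"
    using a subgroup_automorphisms[OF H] rist_iff by auto
  have x: "x \<in> verts T" "a x = x"
    using adj_verts[OF xy] fixed side_not[OF xy] by (auto simp: fixes_outside_def)
  obtain z where z: "z \<in> verts T" "a z \<noteq> z"
    using aut_eqI[OF aa one_automorphism] Aut_one a(2) by metis
  have "a z \<noteq> z \<longrightarrow> (\<exists>w\<in>verts T. w \<noteq> x \<and> a w \<noteq> w \<and> a (dir w x) = dir w x)"
    using z(1) x(1)
  proof (induction rule: dir_induct)
    case (step z)
    then show ?case by (cases "a (dir z x) = dir z x") auto
  qed (use x in simp)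
  then obtain w where w: "w \<in> verts T" "w \<noteq> x" "a w \<noteq> w" "a (dir w x) = dir w x" using z by blast
  let ?v = "dir w x"
  have wv: "adj T w ?v" "x \<in> side w ?v" using dir_adj dir_side w x by auto
  then have v: "?v \<in> verts T" "adj T ?v w" using adj_verts adj_sym by auto
  then have vaw: "adj T ?v (a w)" using aut_adj[OF aa v(1) w(1)] w(4) by simp
  have mem: "u \<in> side x y" if "u \<in> verts T" "a u \<noteq> u" for u
    using that fixed unfolding fixes_outside_def by blast
  \<comment> \<open>\<open>x\<close> has only the neighbour \<open>y\<close> in the half-tree,
    whereas \<open>w\<close> and \<open>a w\<close> are distinct and both moved.\<close>
  have "?v \<noteq> x"
  proof
    assume "?v = x"
    then have *: "adj T x w" "adj T x (a w)" using v vaw by auto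
    have "a (a w) \<noteq> a w" using aut_inj[OF aa aut_verts[OF aa w(1)] w(1)] w(3) by simp
    then have "w = y" "a w = y"
      using mem[of w] mem[of "a w"] w aut_verts[OF aa w(1)] dir_eqI[OF xy] dir_of_adj *
      by metis+
    then show False using w(3) by simp
  qed
  then have u: "adj T ?v (dir ?v x)" "x \<in> side ?v (dir ?v x)" using dir_adj dir_side v x by auto
  have "a (dir ?v x) = dir ?v x" using aut_dir[OF aa v(1) x(1)] \<open>?v \<noteq> x\<close> w(4) x(2) by simp
  moreover have "dir ?v x \<noteq> w" using u wv side_disjoint[OF wv(1)] by auto
  moreover have "dir ?v x \<noteq> a w"
    using calculation aut_inj[OF aa _ w(1), of "dir ?v x"] adj_verts[OF u(1)] by metis
  ultimately show ?thesis using v(2) vaw u(1) w(3) unfolding branching_def by metis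
qed

text \<open>Conjugation by \<open>H\<close> preserves \<open>L\<close> and permutes the half-trees.
  Having normality in \<open>H\<close> and not just in \<open>L\<close> later allows
  \<open>plusplus T M\<close> to be compared with normal subgroups of the original group.\<close>

lemma plusplus_normal:
  assumes H: "subgroup H (Aut T)" and L: "L \<lhd> Aut T\<lparr>carrier := H\<rparr>"
  shows "plusplus T L \<lhd> Aut T\<lparr>carrier := H\<rparr>"
proof -
  let ?X = "\<Union>Y\<in>half_trees T. rist T L Y"
  interpret G: group "Aut T" by (rule group_Aut)
  interpret K: group "Aut T\<lparr>carrier := H\<rparr>" using G.subgroup_imp_group[OF H] .
  have LH: "L \<subseteq> H" using normal_imp_subgroup[OF L] subgroup.subset by force
  have X: "?X \<subseteq> H" using LH by (auto simp: rist_def)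
  have "generate (Aut T\<lparr>carrier := H\<rparr>) ?X \<lhd> Aut T\<lparr>carrier := H\<rparr>"
  proof (rule K.normal_generateI)
    show "?X \<subseteq> carrier (Aut T\<lparr>carrier := H\<rparr>)" using X by simp
  next
    fix a h assume a: "a \<in> ?X" and h: "h \<in> carrier (Aut T\<lparr>carrier := H\<rparr>)"
    obtain x y where xy: "adj T x y" "a \<in> L" "fixes_outside a (side x y)"
      using a by (rule rist_half_treeE)
    have hH: "h \<in> H" using h by simp
    have ha: "h \<in> automorphisms T" using hH subgroup_automorphisms[OF H] by blast
    have aa: "a \<in> automorphisms T" using xy LH subgroup_automorphisms[OF H] by blast
    let ?c = "h \<otimes>\<^bsub>Aut T\<^esub> a \<otimes>\<^bsub>Aut T\<^esub> inv\<^bsub>Aut T\<^esub> h"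
    have inv: "inv\<^bsub>Aut T\<lparr>carrier := H\<rparr>\<^esub> h = inv\<^bsub>Aut T\<^esub> h" using G.m_inv_consistent[OF H hH] .
    have "?c \<in> L" using normal.inv_op_closed2[OF L h xy(2)] inv by simp
    moreover have "fixes_outside ?c (side (h x) (h y))"
      using fixes_outside_conj[OF ha aa xy(3)] aut_side_image[OF ha xy(1)] by simp
    moreover have "adj T (h x) (h y)" using xy(1) adj_verts[OF xy(1)] aut_adj[OF ha] by simp
    ultimately have "?c \<in> ?X" using side_half_tree rist_iff by blast
    then show "h \<otimes>\<^bsub>Aut T\<lparr>carrier := H\<rparr>\<^esub> a \<otimes>\<^bsub>Aut T\<lparr>carrier := H\<rparr>\<^esub> inv\<^bsub>Aut T\<lparr>carrier := H\<rparr>\<^esub> h \<in> ?X"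
      using inv by simp
  qed
  then show ?thesis unfolding plusplus_def G.generate_consistent[OF X H] .
qed

lemma derived_normal:
  assumes H: "subgroup H (Aut T)" and L: "L \<lhd> Aut T\<lparr>carrier := H\<rparr>"
  shows "derived (Aut T) L \<lhd> Aut T\<lparr>carrier := H\<rparr>"
proof -
  interpret G: group "Aut T" by (rule group_Aut)
  have "L \<subseteq> H" using normal_imp_subgroup[OF L] subgroup.subset by force
  then show ?thesis
    using group.derived_is_normal[OF G.subgroup_imp_group[OF H] L] G.derived_consistent[OF _ H] by simp
qed

lemma self_normal: "subgroup H (Aut T) \<Longrightarrow> H \<lhd> Aut T\<lparr>carrier := H\<rparr>"
  using group.normal_self[OF group.subgroup_imp_group[OF group_Aut]] by fastforce

text \<open>Modulo \<open>N\<close>, a rigid stabiliser does not change when its half-tree is moved by \<open>N\<close>, and \<open>N\<close>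
  can make any two half-trees disjoint.\<close>

lemma derived_plusplus_le_normal:
  assumes H: "subgroup H (Aut T)" and D: "dense H" and br: branching
    and N: "N \<lhd> Aut T\<lparr>carrier := H\<rparr>" "N \<noteq> {\<one>\<^bsub>Aut T\<^esub>}"
  shows "derived (Aut T) (plusplus T H) \<subseteq> N"
proof -
  let ?X = "\<Union>Y\<in>half_trees T. rist T H Y"
  interpret G: group "Aut T" by (rule group_Aut)
  interpret K: group "Aut T\<lparr>carrier := H\<rparr>" using G.subgroup_imp_group[OF H] .
  have X: "?X \<subseteq> H" by (auto simp: rist_def)
  have NT: "subgroup N (Aut T)" using normal_subgroup[OF H N(1)] .
  have NH: "N \<subseteq> H" using normal_imp_subgroup[OF N(1)] subgroup.subset by force
  have ND: "dense N" using normal_dense[OF H N(1) D N(2) br] .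
  have "derived (Aut T\<lparr>carrier := H\<rparr>) (generate (Aut T\<lparr>carrier := H\<rparr>) ?X) \<subseteq> N"
  proof (rule K.derived_generate_le_normal[OF N(1)])
    show "?X \<subseteq> carrier (Aut T\<lparr>carrier := H\<rparr>)" using X by simp
  next
    fix a b assume a: "a \<in> ?X" and b: "b \<in> ?X"
    obtain x y where xy: "adj T x y" "a \<in> H" "fixes_outside a (side x y)"
      using a by (rule rist_half_treeE)
    obtain z w where zw: "adj T z w" "b \<in> H" "fixes_outside b (side z w)"
      using b by (rule rist_half_treeE)
    \<comment> \<open>The target \<open>side w z\<close> is the complement of the half-tree on which
      \<open>b\<close> is rigid.\<close>
    obtain n where n: "n \<in> N" "n ` side x y \<subseteq> side w z"
      using half_tree_transitive[OF NT ND xy(1) adj_sym[OF zw(1)]] by blast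
    have A: "a \<in> automorphisms T" "b \<in> automorphisms T" "n \<in> automorphisms T"
      using xy zw n NH subgroup_automorphisms[OF H] by auto
    let ?c = "n \<otimes>\<^bsub>Aut T\<^esub> a \<otimes>\<^bsub>Aut T\<^esub> inv\<^bsub>Aut T\<^esub> n"
    have "?c \<in> automorphisms T"
      by (intro mult_automorphism A subsetD[OF subgroup_automorphisms[OF NT]] subgroup_inv_mem[OF NT n(1)])
    then have "?c \<otimes>\<^bsub>Aut T\<^esub> b = b \<otimes>\<^bsub>Aut T\<^esub> ?c"
      using fixes_outside_commute[OF _ fixes_outside_conj[OF A(3,1) xy(3)] A(2) zw(3)]
        n(2) side_disjoint[OF zw(1)] by auto
    moreover have "inv\<^bsub>Aut T\<lparr>carrier := H\<rparr>\<^esub> n = inv\<^bsub>Aut T\<^esub> n"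
      using G.m_inv_consistent[OF H] n NH by blast
    ultimately show "\<exists>n\<in>N. (n \<otimes>\<^bsub>Aut T\<lparr>carrier := H\<rparr>\<^esub> a \<otimes>\<^bsub>Aut T\<lparr>carrier := H\<rparr>\<^esub> inv\<^bsub>Aut T\<lparr>carrier := H\<rparr>\<^esub> n)
        \<otimes>\<^bsub>Aut T\<lparr>carrier := H\<rparr>\<^esub> b = b \<otimes>\<^bsub>Aut T\<lparr>carrier := H\<rparr>\<^esub>
        (n \<otimes>\<^bsub>Aut T\<lparr>carrier := H\<rparr>\<^esub> a \<otimes>\<^bsub>Aut T\<lparr>carrier := H\<rparr>\<^esub> inv\<^bsub>Aut T\<lparr>carrier := H\<rparr>\<^esub> n)"
      using n(1) by (intro bexI[of _ n]) simp_all
  qed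
  then have "derived (Aut T\<lparr>carrier := H\<rparr>) (plusplus T H) \<subseteq> N"
    unfolding plusplus_def G.generate_consistent[OF X H] .
  then show ?thesis using G.derived_consistent[OF plusplus_incl[OF H] H] by simp
qed

text \<open>As a normal subgroup, \<open>plusplus T H\<close> is itself dense and contains some
  \<open>n\<close> moving \<open>side x y\<close> off itself. If \<open>n\<close> commuted with
  \<open>a\<close>, then \<open>a\<close> would be rigid on two disjoint half-trees.\<close>

lemma derived_plusplus_nontrivial:
  assumes H: "subgroup H (Aut T)" and D: "dense H" and pp: "plusplus T H \<noteq> {\<one>\<^bsub>Aut T\<^esub>}"
  shows "derived (Aut T) (plusplus T H) \<noteq> {\<one>\<^bsub>Aut T\<^esub>}"
proof
  assume triv: "derived (Aut T) (plusplus T H) = {\<one>\<^bsub>Aut T\<^esub>}"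
  interpret G: group "Aut T" by (rule group_Aut)
  obtain x y a where xy: "adj T x y" and a: "a \<in> rist T H (side x y)" "a \<noteq> \<one>\<^bsub>Aut T\<^esub>"
    using plusplus_nontrivial[OF H pp] .
  have P: "plusplus T H \<lhd> Aut T\<lparr>carrier := H\<rparr>" using plusplus_normal[OF H self_normal[OF H]] .
  have PD: "dense (plusplus T H)"
    using normal_dense[OF H P D pp branching_if_rist[OF H xy a]] .
  note PT = normal_subgroup[OF H P]
  obtain n where n: "n \<in> plusplus T H" "n ` side x y \<inter> side x y = {}"
    using exists_disjoint_translate[OF PT PD xy] by blast
  have aP: "a \<in> plusplus T H" using plusplus_mem[OF xy a(1)] .
  have A: "a \<in> automorphisms T" "n \<in> automorphisms T"
    using aP n(1) subgroup_automorphisms[OF PT] by auto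
  then have c: "a \<in> carrier (Aut T)" "n \<in> carrier (Aut T)" using carrier_Aut by auto
  have "n \<otimes>\<^bsub>Aut T\<^esub> a \<otimes>\<^bsub>Aut T\<^esub> inv\<^bsub>Aut T\<^esub> n \<otimes>\<^bsub>Aut T\<^esub> inv\<^bsub>Aut T\<^esub> a \<in> derived (Aut T) (plusplus T H)"
    unfolding derived_def using aP n(1) by (blast intro: generate.incl)
  then have "n \<otimes>\<^bsub>Aut T\<^esub> a \<otimes>\<^bsub>Aut T\<^esub> inv\<^bsub>Aut T\<^esub> n = a"
    using triv c G.inv_solve_right'[of "\<one>\<^bsub>Aut T\<^esub>" "n \<otimes>\<^bsub>Aut T\<^esub> a \<otimes>\<^bsub>Aut T\<^esub> inv\<^bsub>Aut T\<^esub> n" a] by simp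
  then have "fixes_outside a (n ` side x y)" "fixes_outside a (side x y)"
    using fixes_outside_conj[OF A(2,1)] a(1) rist_iff by metis+
  then show False using fixes_outside_disjoint[OF A(1)] n(2) a(2) by blast
qed

text \<open>Two conjugates of a rigid element by \<open>M\<close>, supported on two of three half-trees at a branch
  vertex, have their quotient in \<open>M\<close>.\<close>

lemma plusplus_normal_nontrivial:
  assumes H: "subgroup H (Aut T)" and D: "dense H" and pp: "plusplus T H \<noteq> {\<one>\<^bsub>Aut T\<^esub>}"
    and M: "M \<lhd> Aut T\<lparr>carrier := H\<rparr>" "M \<noteq> {\<one>\<^bsub>Aut T\<^esub>}"
  shows "plusplus T M \<noteq> {\<one>\<^bsub>Aut T\<^esub>}"
proof
  assume triv: "plusplus T M = {\<one>\<^bsub>Aut T\<^esub>}"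
  interpret G: group "Aut T" by (rule group_Aut)
  obtain x y a where xy: "adj T x y" and a: "a \<in> rist T H (side x y)" "a \<noteq> \<one>\<^bsub>Aut T\<^esub>"
    using plusplus_nontrivial[OF H pp] .
  have br: branching using branching_if_rist[OF H xy a] .
  have MT: "subgroup M (Aut T)" using normal_subgroup[OF H M(1)] .
  have MD: "dense M" using normal_dense[OF H M(1) D M(2) br] .
  obtain v w1 w2 w3 where v: "adj T v w1" "adj T v w2" "adj T v w3" "w1 \<noteq> w2" "w1 \<noteq> w3" "w2 \<noteq> w3"
    using br unfolding branching_def by blast
  obtain n1 where n1: "n1 \<in> M" "n1 ` side x y \<subseteq> side v w1"
    using half_tree_transitive[OF MT MD xy v(1)] by blast
  obtain n2 where n2: "n2 \<in> M" "n2 ` side x y \<subseteq> side v w2"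
    using half_tree_transitive[OF MT MD xy v(2)] by blast
  \<comment> \<open>The commutator of \<open>n\<close> and \<open>a\<close>, bracketed so that for
    \<open>n\<close> in \<open>M\<close> its second factor is a conjugate of the inverse of
    \<open>n\<close>, hence in \<open>M\<close>.\<close>
  let ?m = "\<lambda>n. n \<otimes>\<^bsub>Aut T\<^esub> (a \<otimes>\<^bsub>Aut T\<^esub> inv\<^bsub>Aut T\<^esub> n \<otimes>\<^bsub>Aut T\<^esub> inv\<^bsub>Aut T\<^esub> a)"
  let ?c = "\<lambda>n. n \<otimes>\<^bsub>Aut T\<^esub> a \<otimes>\<^bsub>Aut T\<^esub> inv\<^bsub>Aut T\<^esub> n"
  have aH: "a \<in> H" "fixes_outside a (side x y)" using a(1) rist_iff by auto
  have aa: "a \<in> automorphisms T" using aH subgroup_automorphisms[OF H] by blast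
  then have ac: "a \<in> carrier (Aut T)" using carrier_Aut by simp
  have nA: "n \<in> automorphisms T" "n \<in> carrier (Aut T)" if "n \<in> M" for n
    using that subgroup_automorphisms[OF MT] carrier_Aut by auto
  have mM: "?m n \<in> M" if n: "n \<in> M" for n
  proof -
    have "inv\<^bsub>Aut T\<lparr>carrier := H\<rparr>\<^esub> a = inv\<^bsub>Aut T\<^esub> a" using G.m_inv_consistent[OF H aH(1)] .
    then have "a \<otimes>\<^bsub>Aut T\<^esub> inv\<^bsub>Aut T\<^esub> n \<otimes>\<^bsub>Aut T\<^esub> inv\<^bsub>Aut T\<^esub> a \<in> M"
      using normal.inv_op_closed2[OF M(1), of a "inv\<^bsub>Aut T\<^esub> n"] aH(1) subgroup_inv_mem[OF MT n] by simp
    then show ?thesis using subgroup.m_closed[OF MT n] by blast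
  qed
  have cm: "?c n = ?m n \<otimes>\<^bsub>Aut T\<^esub> a" if "n \<in> M" for n
    using nA[OF that] ac by (simp add: G.m_assoc)
  let ?d = "?m n1 \<otimes>\<^bsub>Aut T\<^esub> inv\<^bsub>Aut T\<^esub> ?m n2"
  have m12: "?m n1 \<in> carrier (Aut T)" "?m n2 \<in> carrier (Aut T)"
    using mM n1 n2 nA by blast+
  have dM: "?d \<in> M"
    using subgroup.m_closed[OF MT mM[OF n1(1)] subgroup_inv_mem[OF MT mM[OF n2(1)]]] .
  have dA: "?d \<in> automorphisms T" using nA(1)[OF dM] .
  have c12: "?c n1 \<in> automorphisms T" "?c n2 \<in> automorphisms T"
    using cm n1 n2 mM nA mult_automorphism aa by metis+
  have dc: "?d \<otimes>\<^bsub>Aut T\<^esub> ?c n2 = ?c n1"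
    using m12 ac by (simp add: cm[OF n1(1)] cm[OF n2(1)] G.m_assoc G.inv_solve_left')
  have sc1: "fixes_outside (?c n1) (side v w1)" and sc2: "fixes_outside (?c n2) (side v w2)"
    using fixes_outside_conj[OF nA(1)[OF n1(1)] aa aH(2)] fixes_outside_conj[OF nA(1)[OF n2(1)] aa aH(2)]
      n1(2) n2(2) unfolding fixes_outside_def by blast+
  have disj: "side v w1 \<inter> side v w2 = {}" "side v w3 \<inter> side v w1 = {}" "side v w3 \<inter> side v w2 = {}"
    using side_inter_eq v by blast+
  \<comment> \<open>Both conjugates fix the third half-tree \<open>side v w3\<close>, so their
    quotient is rigid on its complement.\<close>
  have "fixes_outside ?d (side w3 v)"
    unfolding fixes_outside_def
  proof
    fix u assume u: "u \<in> verts T - side w3 v"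
    then have uV: "u \<in> verts T" "u \<in> side v w3" using side_compl[OF v(3)] by auto
    then have "u \<notin> side v w1" "u \<notin> side v w2" using disj by auto
    then have "?c n1 u = u" "?c n2 u = u" using sc1 sc2 uV unfolding fixes_outside_def by blast+
    then show "?d u = u" using Aut_mult[OF dA c12(2) uV(1)] dc by simp
  qed
  then have "?d \<in> plusplus T M" using dM rist_iff plusplus_mem[OF adj_sym[OF v(3)]] by blast
  then have "?d = \<one>\<^bsub>Aut T\<^esub>" using triv by blast
  then have "?c n2 = ?c n1" using dc c12(2) carrier_Aut by simp
  \<comment> \<open>The two conjugates now coincide, although they are supported on disjoint
    half-trees.\<close>
  then have "?c n1 = \<one>\<^bsub>Aut T\<^esub>" using fixes_outside_disjoint[OF c12(1) sc1] sc2 disj(1) by simp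
  then show False using conj_eq_one[OF nA(1)[OF n1(1)] aa] a(2) by blast
qed

end

section \<open>The monolith and its simplicity\<close>

theorem corollary1p8:
  fixes T :: "'v ugraph" and G :: "('v \<Rightarrow> 'v) set"
  assumes "is_tree T"
    and "subgroup G (Aut T)"
    and "geometrically_dense T G"
    and "plusplus T G \<noteq> {\<one>\<^bsub>Aut T\<^esub>}"
  shows "almost_simple (Aut T\<lparr>carrier := G\<rparr>)
    \<and> monolith (Aut T\<lparr>carrier := G\<rparr>) = derived (Aut T) (plusplus T G)
    \<and> geometrically_dense T (derived (Aut T) (plusplus T G))"
proof -
  interpret tree T by unfold_locales (rule assms)
  interpret A: group "Aut T" by (rule group_Aut)
  note G = assms(2) and pp = assms(4)
  define M where "M = derived (Aut T) (plusplus T G)"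
  have D: "dense G" using geometrically_dense_iff[OF G] assms(3) by blast
  have br: branching using plusplus_nontrivial[OF G pp] branching_if_rist[OF G] by metis
  have M_le: "M \<subseteq> N" if "N \<lhd> Aut T\<lparr>carrier := G\<rparr>" "N \<noteq> {\<one>\<^bsub>Aut T\<^esub>}" for N
    unfolding M_def using derived_plusplus_le_normal[OF G D br that] .
  have M: "M \<lhd> Aut T\<lparr>carrier := G\<rparr>" "M \<noteq> {\<one>\<^bsub>Aut T\<^esub>}"
    unfolding M_def using derived_normal[OF G plusplus_normal[OF G self_normal[OF G]]]
      derived_plusplus_nontrivial[OF G D pp] by blast+
  have MT: "subgroup M (Aut T)" using normal_subgroup[OF G M(1)] .
  have MG: "M \<subseteq> G" using normal_imp_subgroup[OF M(1)] subgroup.subset by force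
  have MD: "dense M" using normal_dense[OF G M(1) D M(2) br] .
  have monolith: "monolith (Aut T\<lparr>carrier := G\<rparr>) = M"
    using M M_le MG unfolding monolith_def by auto
  let ?D = "derived (Aut T) (plusplus T M)"
  have ppM: "plusplus T M \<noteq> {\<one>\<^bsub>Aut T\<^esub>}" using plusplus_normal_nontrivial[OF G D pp M] .
  have D_ne: "?D \<noteq> {\<one>\<^bsub>Aut T\<^esub>}" using derived_plusplus_nontrivial[OF MT MD ppM] .
  \<comment> \<open>\<open>?D\<close> is a non-trivial normal subgroup of \<open>G\<close>, so it
    contains \<open>M\<close>. Every non-trivial normal subgroup of \<open>M\<close> contains
    \<open>?D\<close> by \<open>derived_plusplus_le_normal\<close>, and therefore equals
    \<open>M\<close>.\<close>
  have "M \<subseteq> ?D" using M_le[OF derived_normal[OF G plusplus_normal[OF G M(1)]] D_ne] .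
  then have simple: "N = M" if "N \<lhd> Aut T\<lparr>carrier := M\<rparr>" "N \<noteq> {\<one>\<^bsub>Aut T\<^esub>}" for N
    using derived_plusplus_le_normal[OF MT MD br that] normal_imp_subgroup[OF that(1)]
      subgroup.subset by force
  have "\<not> comm_group (Aut T\<lparr>carrier := M\<rparr>)"
  proof
    assume "comm_group (Aut T\<lparr>carrier := M\<rparr>)"
    then have "derived (Aut T\<lparr>carrier := M\<rparr>) (plusplus T M) = {\<one>\<^bsub>Aut T\<^esub>}"
      using comm_group.derived_eq_singleton plusplus_incl[OF MT] by fastforce
    then show False using D_ne A.derived_consistent[OF plusplus_incl[OF MT] MT] by simp
  qed
  moreover have "is_simple (Aut T\<lparr>carrier := M\<rparr>)"
    using simple M(2) A.subgroup_imp_group[OF MT] by (auto simp: is_simple_def)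
  ultimately have "almost_simple (Aut T\<lparr>carrier := G\<rparr>)"
    using A.subgroup_imp_group[OF G] by (simp add: almost_simple_def monolith)
  moreover have "geometrically_dense T M" using geometrically_dense_iff[OF MT] MD by blast
  ultimately show ?thesis using monolith unfolding M_def by blast
qed

end
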